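(* Let $\Xi\subset\mathbb{R}$ be an open set containing $0$, let $f\in C^4(\mathbb{R})$ be a probability density function on $\mathbb{R}$, and suppose that the moment generating function $M_f(t)=\int_{\mathbb{R}}e^{tz}f(z)\,dz$ is finite for all $t\in2\Xi=\{2\xi\mid\xi\in\Xi\}$. Then the Wasserstein information matrix of the location-scale-shape model $\mathcal{S}_f$ with respect to the parametrization $\theta=(\mu,\sigma,\xi)\in\mathbb{R}\times\mathbb{R}_{>0}\times\Xi$ is the symmetric $3\times3$ matrix $I^W(\theta)$ with entries $$I^W(\theta)_{11}=1,\qquad I^W(\theta)_{12}=\frac1\xi\left(M_f(\xi)-1\right),\qquad I^W(\theta)_{13}=\frac{\sigma}{\xi^2}\left(\xi M_f'(\xi)-M_f(\xi)+1\right),$$ $$I^W(\theta)_{22}=\frac1{\xi^2}\left(M_f(2\xi)-2M_f(\xi)+1\right),$$ $$I^W(\theta)_{23}=\frac{\sigma}{\xi^3}\left(\xi M_f'(2\xi)-\xi M_f'(\xi)-M_f(2\xi)+2M_f(\xi)-1\right),$$ $$I^W(\theta)_{33}=\frac{\sigma^2}{\xi^4}\left(\xi^2M_f''(2\xi)-2\xi M_f'(2\xi)+2\xi M_f'(\xi)+M_f(2\xi)-2M_f(\xi)+1\right),$$ where at $\xi=0$ the right-hand sides are understood as their limits as $\xi\to0$.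
   Context: Location-scale-shape model generated by $f$: $\mathcal{S}_f=\{p(\cdot;\theta)\mid \theta=(\mu,\sigma,\xi)\in\mathbb{R}\times\mathbb{R}_{>0}\times\Xi\}$, where, for $\xi\neq 0$, $p(x;\theta)=\frac1\sigma\left(1+\xi\frac{x-\mu}{\sigma}\right)^{-1}f\left(\frac1\xi\log\left(1+\xi\frac{x-\mu}{\sigma}\right)\right)$ if $1+\xi\frac{x-\mu}{\sigma}>0$ and $p(x;\theta)=0$ otherwise; and, for $\xi=0$, $p(x;\theta)=\frac1\sigma f\left(\frac{x-\mu}{\sigma}\right)$. Wasserstein score functions: for a parametric family of densities $p(x;\theta)$ on $\mathbb{R}$, the Wasserstein score function $\Phi^W_i(x;\theta)$ of the parameter $\theta_i$ is a solution of $\frac{\partial}{\partial x}\left(p(x;\theta)\frac{\partial}{\partial x}\Phi^W_i(x;\theta)\right)=-\frac{\partial}{\partial\theta_i}p(x;\theta)$ with $\mathbb{E}_\theta[\Phi^W_i(X;\theta)]=0$. For $\mathcal{S}_f$ the score functions used are, on $\{x: 1+\xi\frac{x-\mu}{\sigma}>0\}$ and with $t=1+\xi\frac{x-\mu}{\sigma}$: $\Phi^W_\mu=x-\mathbb{E}_\theta[X]$; $\Phi^W_\sigma=\frac{(x-\mu)^2}{2\sigma}-c_1(\theta)$; $\Phi^W_\xi=\frac{\sigma^2}{\xi^3}\left(\frac12t^2\log t-\frac34t^2+t\right)-c_2(\theta)$ for $\xi\ne0$ and $\Phi^W_\xi=\frac{\sigma^2}{6}\left(\frac{x-\mu}{\sigma}\right)^3-c_2(\theta)$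 for $\xi=0$, where $c_1,c_2$ are the constants (in $x$) making the expectations zero. Wasserstein information matrix: with indices $1,2,3$ corresponding to $\mu,\sigma,\xi$, $I^W(\theta)_{ij}=\mathbb{E}_\theta\left[\partial_x\Phi^W_i(X;\theta)\,\partial_x\Phi^W_j(X;\theta)\right]$, where $X\sim p(\cdot;\theta)$. *)

theory Defs
  imports "HOL-Analysis.Analysis"
begin

definition C4 :: "(real \<Rightarrow> real) \<Rightarrow> bool" where
  "C4 f \<longleftrightarrow> (\<forall>k<4. \<forall>x. (deriv ^^ k) f differentiable at x) \<and> continuous_on UNIV ((deriv ^^ 4) f)"

definition prob_density :: "(real \<Rightarrow> real) \<Rightarrow> bool" where
  "prob_density f \<longleftrightarrow> (\<forall>x. 0 \<le> f x) \<and> has_bochner_integral lborel f 1"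

definition mgf :: "(real \<Rightarrow> real) \<Rightarrow> real \<Rightarrow> real" where
  "mgf f t = (\<integral>z. exp (t * z) * f z \<partial>lborel)"

definition mgf_finite :: "(real \<Rightarrow> real) \<Rightarrow> real \<Rightarrow> bool" where
  "mgf_finite f t \<longleftrightarrow> integrable lborel (\<lambda>z. exp (t * z) * f z)"


text \<open>A parametric family of densities on the real line is a function
  \<open>p :: real ^ 'n \<Rightarrow> real \<Rightarrow> real\<close>, with \<open>p \<theta> x\<close> standing for $p(x;\theta)$.\<close>

definition law :: "(real ^ 'n \<Rightarrow> real \<Rightarrow> real) \<Rightarrow> real ^ 'n \<Rightarrow> real measure" where
  "law p \<theta> = density lborel (\<lambda>x. ennreal (p \<theta> x))"

text \<open>\<open>\<Phi>\<close> is a Wasserstein score function for the \<open>i\<close>-th parameter at \<open>\<theta>\<close>: it solves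
  $\partial_x (p\,\partial_x \Phi) = -\partial_{\theta_i} p$ and has mean zero. The equation is required
  on an open set \<open>D\<close> outside of which \<open>p \<theta>\<close> vanishes (a density need not be differentiable at the
  boundary of its support). All derivatives and the expectation are required to exist;
  \<open>d\<close> is the value of $\partial_{\theta_i} p(x;\theta)$.\<close>

definition wasserstein_score ::
  "(real ^ 'n \<Rightarrow> real \<Rightarrow> real) \<Rightarrow> real set \<Rightarrow> real ^ 'n \<Rightarrow> 'n \<Rightarrow> (real \<Rightarrow> real) \<Rightarrow> bool" where
  "wasserstein_score p D \<theta> i \<Phi> \<longleftrightarrow>
     (\<forall>x\<in>D. \<Phi> differentiable at x \<and>
        (\<exists>d. ((\<lambda>s. p (\<theta> + s *\<^sub>R axis i 1) x) has_real_derivative d) (at 0) \<and>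
             ((\<lambda>y. p \<theta> y * deriv \<Phi> y) has_real_derivative - d) (at x))) \<and>
     has_bochner_integral (law p \<theta>) \<Phi> 0"

definition wasserstein_information ::
  "(real ^ 'n \<Rightarrow> real \<Rightarrow> real) \<Rightarrow> real ^ 'n \<Rightarrow> ('n \<Rightarrow> real \<Rightarrow> real) \<Rightarrow> real ^ 'n ^ 'n" where
  "wasserstein_information p \<theta> \<Phi> = (\<chi> i j. \<integral>x. deriv (\<Phi> i) x * deriv (\<Phi> j) x \<partial>law p \<theta>)"


text \<open>The location-scale-shape model, with \<open>\<theta> $ 1\<close>, \<open>\<theta> $ 2\<close>, \<open>\<theta> $ 3\<close> the parameters
  $\mu$, $\sigma$, $\xi$.\<close>

definition lss_arg :: "real ^ 3 \<Rightarrow> real \<Rightarrow> real" where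
  "lss_arg \<theta> x = 1 + \<theta> $ 3 * ((x - \<theta> $ 1) / \<theta> $ 2)"

definition lss_domain :: "real ^ 3 \<Rightarrow> real set" where
  "lss_domain \<theta> = {x. lss_arg \<theta> x > 0}"

definition lss_density :: "(real \<Rightarrow> real) \<Rightarrow> real ^ 3 \<Rightarrow> real \<Rightarrow> real" where
  "lss_density f \<theta> x =
     (if \<theta> $ 3 = 0 then 1 / \<theta> $ 2 * f ((x - \<theta> $ 1) / \<theta> $ 2)
      else if x \<in> lss_domain \<theta>
      then 1 / \<theta> $ 2 * inverse (lss_arg \<theta> x) * f (1 / \<theta> $ 3 * ln (lss_arg \<theta> x))
      else 0)"

text \<open>The three score functions before centering.\<close>

definition lss_potential :: "real ^ 3 \<Rightarrow> 3 \<Rightarrow> real \<Rightarrow> real" where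
  "lss_potential \<theta> i x =
     (let \<mu> = \<theta> $ 1; \<sigma> = \<theta> $ 2; \<xi> = \<theta> $ 3; t = lss_arg \<theta> x in
      if i = 1 then x
      else if i = 2 then (x - \<mu>)\<^sup>2 / (2 * \<sigma>)
      else if \<xi> = 0 then \<sigma>\<^sup>2 / 6 * ((x - \<mu>) / \<sigma>) ^ 3
      else \<sigma>\<^sup>2 / \<xi> ^ 3 * (1 / 2 * t\<^sup>2 * ln t - 3 / 4 * t\<^sup>2 + t))"

text \<open>The scores are only specified on \<open>lss_domain \<theta>\<close>; the value 0 elsewhere is immaterial,
  as the density vanishes there.\<close>

definition lss_score :: "(real \<Rightarrow> real) \<Rightarrow> real ^ 3 \<Rightarrow> 3 \<Rightarrow> real \<Rightarrow> real" where
  "lss_score f \<theta> i x =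
     (if x \<in> lss_domain \<theta>
      then lss_potential \<theta> i x - (\<integral>y. lss_potential \<theta> i y \<partial>law (lss_density f) \<theta>)
      else 0)"

text \<open>The closed form, for $\xi \neq 0$, in terms of a moment generating function \<open>M\<close>.\<close>

definition lss_information_formula :: "(real \<Rightarrow> real) \<Rightarrow> real \<Rightarrow> real \<Rightarrow> real ^ 3 ^ 3" where
  "lss_information_formula M \<sigma> \<xi> =
     (let M' = deriv M; M'' = deriv (deriv M);
          I12 = 1 / \<xi> * (M \<xi> - 1);
          I13 = \<sigma> / \<xi>\<^sup>2 * (\<xi> * M' \<xi> - M \<xi> + 1);
          I22 = 1 / \<xi>\<^sup>2 * (M (2 * \<xi>) - 2 * M \<xi> + 1);
          I23 = \<sigma> / \<xi> ^ 3 * (\<xi> * M' (2 * \<xi>) - \<xi> * M' \<xi> - M (2 * \<xi>) + 2 * M \<xi> - 1);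
          I33 = \<sigma>\<^sup>2 / \<xi> ^ 4 * (\<xi>\<^sup>2 * M'' (2 * \<xi>) - 2 * \<xi> * M' (2 * \<xi>) + 2 * \<xi> * M' \<xi>
                  + M (2 * \<xi>) - 2 * M \<xi> + 1)
      in vector [vector [1,   I12, I13],
                 vector [I12, I22, I23],
                 vector [I13, I23, I33]])"

end

theory Submission
  imports Defs
begin

text \<open>
  The law of the model at \<open>\<theta> = (\<mu>, \<sigma>, \<xi>)\<close> is the image of the law with density \<open>f\<close> under
  \<open>T z = \<mu> + \<sigma> (exp (\<xi> z) - 1) / \<xi>\<close> (\<open>T z = \<mu> + \<sigma> z\<close> for \<open>\<xi> = 0\<close>), whose range is exactly the domain
  of the scores. Pulled back along \<open>T\<close>, the derivatives of the scores are combinations of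
  \<open>z ^ k * exp (c * z)\<close> with \<open>c\<close> among \<open>0\<close>, \<open>\<xi>\<close>, \<open>2 \<xi>\<close>. Since \<open>\<Xi>\<close> is open and contains \<open>0\<close> and \<open>\<xi>\<close>,
  these exponents are interior to an interval on which \<open>M\<^sub>f\<close> is finite; hence all moments exist and
  the entries are read off from \<open>M\<^sub>f\<close> and its derivatives. The same integral representation is
  continuous at \<open>\<xi> = 0\<close> by dominated convergence, which gives the limit without expanding the
  closed form.
\<close>

section \<open>Moments against an exponentially tilted density\<close>

text \<open>The left side, divided by \<open>fact k\<close>, is a single term of the exponential
  series, whose terms are all nonnegative for \<open>0 \<le> x\<close>. It trades polynomial factors
  for a small change of exponential rate.\<close>

lemma power_le_fact_exp:
  fixes x :: real
  assumes "0 \<le> x"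
  shows "x ^ k \<le> fact k * exp x"
proof -
  have sm: "summable (\<lambda>n. x ^ n /\<^sub>R fact n)"
    by (rule summable_exp_generic)
  have "sum (\<lambda>n. x ^ n /\<^sub>R fact n) {k} \<le> (\<Sum>n. x ^ n /\<^sub>R fact n)"
    by (rule sum_le_suminf[OF sm]) (use assms in auto)
  then have "x ^ k / fact k \<le> exp x"
    by (simp add: exp_def divide_inverse mult.commute)
  then show ?thesis
    by (simp add: field_simps)
qed

text \<open>As a function of the rate \<open>s\<close>, the exponential is monotone for
  \<open>z \<ge> 0\<close> and antitone otherwise, so one of the two endpoint rates always
  dominates.\<close>

lemma exp_le_add_exp:
  fixes s z :: real
  assumes "a \<le> s" "s \<le> b"
  shows "exp (s * z) \<le> exp (a * z) + exp (b * z)"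
proof (cases "0 \<le> z")
  case True
  then have "s * z \<le> b * z"
    using assms by (intro mult_right_mono)
  then show ?thesis
    by (smt (verit) exp_le_cancel_iff exp_gt_zero)
next
  case False
  then have "s * z \<le> a * z"
    using assms by (intro mult_right_mono_neg) auto
  then show ?thesis
    by (smt (verit) exp_le_cancel_iff exp_gt_zero)
qed

text \<open>On each half-line the left side is one exponential, of rate \<open>t + e\<close> or
  \<open>t - e\<close>, and both rates lie in \<open>[a, b]\<close>.\<close>

lemma exp_tilt_le:
  fixes t e z :: real
  assumes "0 \<le> e" "a \<le> t - e" "t + e \<le> b"
  shows "exp (t * z) * exp (e * \<bar>z\<bar>) \<le> exp (a * z) + exp (b * z)"
proof (cases "0 \<le> z")
  case True
  then have "exp (t * z) * exp (e * \<bar>z\<bar>) = exp ((t + e) * z)"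
    by (simp flip: exp_add add: algebra_simps)
  then show ?thesis
    using exp_le_add_exp[of a "t + e" b z] assms by simp
next
  case False
  then have "exp (t * z) * exp (e * \<bar>z\<bar>) = exp ((t - e) * z)"
    by (simp flip: exp_add add: algebra_simps)
  then show ?thesis
    using exp_le_add_exp[of a "t - e" b z] assms by simp
qed

text \<open>Because \<open>t\<close> is strictly inside \<open>(a, b)\<close>, there is a margin
  \<open>e\<close> on both sides; the power \<open>z ^ k\<close> is absorbed by
  \<open>exp (e * \<bar>z\<bar>)\<close>, and the widened rates are still controlled by the
  endpoints.\<close>

lemma integrable_exp_moment:
  fixes f :: "real \<Rightarrow> real"
  assumes nonneg: "\<And>z. 0 \<le> f z" and meas: "f \<in> borel_measurable borel"
    and fin: "mgf_finite f a" "mgf_finite f b" and t: "a < t" "t < b"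
  shows "integrable lborel (\<lambda>z. z ^ k * exp (t * z) * f z)"
proof -
  obtain e where e: "0 < e" "a \<le> t - e" "t + e \<le> b"
  proof
    let ?e = "min (t - a) (b - t)"
    show "0 < ?e" "a \<le> t - ?e" "t + ?e \<le> b"
      using t by auto
  qed
  \<comment> \<open>The constant in
    \<open>\<bar>z\<bar> ^ k \<le> C * exp (e * \<bar>z\<bar>)\<close>, obtained from
    \<open>power_le_fact_exp\<close> at \<open>e * \<bar>z\<bar>\<close>.\<close>
  define C where "C = fact k / e ^ k"
  have "0 < C"
    using e by (simp add: C_def)
  have int: "integrable lborel (\<lambda>z. C * (exp (a * z) * f z + exp (b * z) * f z))"
    using fin unfolding mgf_finite_def by (intro integrable_mult_right Bochner_Integration.integrable_add)
  show ?thesis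
  proof (rule Bochner_Integration.integrable_bound[OF int])
    show "(\<lambda>z. z ^ k * exp (t * z) * f z) \<in> borel_measurable lborel"
      using meas by simp
    show "AE z in lborel. norm (z ^ k * exp (t * z) * f z) \<le>
        norm (C * (exp (a * z) * f z + exp (b * z) * f z))"
    proof (rule AE_I2)
      fix z
      have "(e * \<bar>z\<bar>) ^ k \<le> fact k * exp (e * \<bar>z\<bar>)"
        using e by (intro power_le_fact_exp) simp
      then have "\<bar>z\<bar> ^ k \<le> C * exp (e * \<bar>z\<bar>)"
        using e by (simp add: C_def field_simps)
      then have "\<bar>z\<bar> ^ k * exp (t * z) * f z \<le> C * exp (e * \<bar>z\<bar>) * exp (t * z) * f z"
        by (intro mult_right_mono nonneg) auto
      also have "\<dots> = C * (exp (t * z) * exp (e * \<bar>z\<bar>)) * f z"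
        by simp
      also have "\<dots> \<le> C * (exp (a * z) + exp (b * z)) * f z"
        using \<open>0 < C\<close> e by (intro mult_right_mono mult_left_mono exp_tilt_le nonneg) auto
      finally show "norm (z ^ k * exp (t * z) * f z) \<le>
          norm (C * (exp (a * z) * f z + exp (b * z) * f z))"
        using nonneg[of z] \<open>0 < C\<close>
        by (simp add: abs_mult power_abs algebra_simps)
    qed
  qed
qed

lemma integral_dominated_convergence_at:
  fixes s :: "real \<Rightarrow> 'a \<Rightarrow> real" and w g :: "'a \<Rightarrow> real"
  assumes r: "0 < r"
    and meas: "g \<in> borel_measurable M" "\<And>h. s h \<in> borel_measurable M"
    and w: "integrable M w"
    and lim: "\<And>z. ((\<lambda>h. s h z) \<longlongrightarrow> g z) (at a)"
    and bound: "\<And>h z. h \<noteq> a \<Longrightarrow> \<bar>h - a\<bar> < r \<Longrightarrow> \<bar>s h z\<bar> \<le> w z"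
  shows "((\<lambda>h. integral\<^sup>L M (s h)) \<longlongrightarrow> integral\<^sup>L M g) (at a)"
proof -
  \<comment> \<open>Localising to the ball makes every term of a test sequence satisfy the
    domination bound, so the sequential dominated convergence theorem applies directly.\<close>
  have at: "at a within ball a r = at a"
    using r by (intro at_within_open) auto
  have "((\<lambda>h. integral\<^sup>L M (s h)) \<longlongrightarrow> integral\<^sup>L M g) (at a within ball a r)"
    unfolding tendsto_at_iff_sequentially comp_def
  proof (intro allI impI)
    fix X assume X: "\<forall>i. X i \<in> ball a r - {a}" "X \<longlonglongrightarrow> a"
    show "(\<lambda>i. integral\<^sup>L M (s (X i))) \<longlonglongrightarrow> integral\<^sup>L M g"
    proof (rule integral_dominated_convergence[OF meas(1) meas(2) w])
      show "AE z in M. (\<lambda>i. s (X i) z) \<longlonglongrightarrow> g z"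
      proof (rule AE_I2)
        fix z
        show "(\<lambda>i. s (X i) z) \<longlonglongrightarrow> g z"
          using lim[of z] X unfolding tendsto_at_iff_sequentially comp_def by auto
      qed
      show "AE z in M. norm (s (X i) z) \<le> w z" for i
        using bound[of "X i"] X by (auto simp: dist_real_def abs_minus_commute)
    qed
  qed
  then show ?thesis
    by (simp add: at)
qed

text \<open>Mean value inequality on \<open>[-\<bar>u\<bar>, \<bar>u\<bar>]\<close>. The factor
  \<open>\<bar>u\<bar>\<close> later cancels a division by \<open>h\<close> or by
  \<open>\<xi>\<close>.\<close>

lemma abs_exp_minus_1_le:
  fixes u :: real
  shows "\<bar>exp u - 1\<bar> \<le> \<bar>u\<bar> * exp \<bar>u\<bar>"
proof -
  have "norm (exp u - exp 0) \<le> exp \<bar>u\<bar> * norm (u - 0)"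
    by (rule field_differentiable_bound[of "{- \<bar>u\<bar>..\<bar>u\<bar>}" exp exp])
      (auto intro!: derivative_eq_intros)
  then show ?thesis
    by (simp add: mult.commute)
qed

text \<open>The derivative of the left-hand expression without absolute value is
  \<open>u * exp u\<close>, which is itself of first order at 0; this yields the quadratic factor
  that cancels \<open>\<xi>\<^sup>2\<close> in the shape component.\<close>

lemma abs_exp_remainder_le:
  fixes u :: real
  shows "\<bar>u * exp u - exp u + 1\<bar> \<le> u\<^sup>2 * exp \<bar>u\<bar>"
proof -
  let ?g = "\<lambda>u::real. u * exp u - exp u + 1"
  have "norm (?g u - ?g 0) \<le> \<bar>u\<bar> * exp \<bar>u\<bar> * norm (u - 0)"
    by (rule field_differentiable_bound[of "{- \<bar>u\<bar>..\<bar>u\<bar>}" ?g "\<lambda>u. u * exp u"])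
      (auto intro!: derivative_eq_intros mult_mono simp: abs_mult)
  then show ?thesis
    by (simp add: power2_eq_square mult.commute mult.left_commute flip: abs_mult)
qed

text \<open>Differentiation under the integral sign: the quotient
  \<open>(exp (h * z) - 1) / h\<close> is at most
  \<open>\<bar>z\<bar> * exp (e * \<bar>z\<bar>)\<close> for \<open>\<bar>h\<bar> < e\<close>, which
  costs one more power of \<open>z\<close> and a shift of the rate by \<open>e\<close>.\<close>

lemma has_real_derivative_exp_moment:
  fixes f :: "real \<Rightarrow> real"
  assumes nonneg: "\<And>z. 0 \<le> f z" and meas: "f \<in> borel_measurable borel"
    and fin: "mgf_finite f a" "mgf_finite f b" and t: "a < t" "t < b"
  shows "((\<lambda>t. \<integral>z. z ^ k * exp (t * z) * f z \<partial>lborel) has_real_derivative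
      (\<integral>z. z ^ Suc k * exp (t * z) * f z \<partial>lborel)) (at t)"
proof -
  note int = integrable_exp_moment[OF nonneg meas fin]
  obtain e where e: "0 < e" "a < t - e" "t + e < b"
  proof
    let ?e = "min (t - a) (b - t) / 2"
    show "0 < ?e" "a < t - ?e" "t + ?e < b"
      using t by (auto simp: min_def field_simps)
  qed
  \<comment> \<open>The rates \<open>t - e\<close> and \<open>t + e\<close> are still strictly
    inside \<open>(a, b)\<close>, so this dominating function is integrable.\<close>
  let ?w = "\<lambda>z. \<bar>z ^ Suc k * exp ((t - e) * z) * f z\<bar> + \<bar>z ^ Suc k * exp ((t + e) * z) * f z\<bar>"
  let ?s = "\<lambda>h z. z ^ k * exp (t * z) * f z * ((exp (h * z) - 1) / h)"
  have "((\<lambda>h. \<integral>z. ?s h z \<partial>lborel) \<longlongrightarrow> (\<integral>z. z ^ Suc k * exp (t * z) * f z \<partial>lborel)) (at 0)"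
  proof (rule integral_dominated_convergence_at[OF e(1)])
    show "(\<lambda>z. z ^ Suc k * exp (t * z) * f z) \<in> borel_measurable lborel"
      using meas by simp
    show "?s h \<in> borel_measurable lborel" for h
      using meas by simp
    show "integrable lborel ?w"
      using e by (intro Bochner_Integration.integrable_add Bochner_Integration.integrable_abs int) auto
    show "((\<lambda>h. ?s h z) \<longlongrightarrow> z ^ Suc k * exp (t * z) * f z) (at 0)" for z
    proof -
      have "((\<lambda>h. exp (h * z)) has_real_derivative z) (at 0)"
        by (auto intro!: derivative_eq_intros)
      then have "((\<lambda>h. (exp (h * z) - 1) / h) \<longlongrightarrow> z) (at 0)"
        by (simp add: has_field_derivative_iff)
      then have "((\<lambda>h. ?s h z) \<longlongrightarrow> z ^ k * exp (t * z) * f z * z) (at 0)"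
        by (rule tendsto_mult_left)
      then show ?thesis
        by (simp add: mult_ac)
    qed
    show "\<bar>?s h z\<bar> \<le> ?w z" if h: "h \<noteq> 0" "\<bar>h - 0\<bar> < e" for h z
    proof -
      have "\<bar>(exp (h * z) - 1) / h\<bar> \<le> \<bar>z\<bar> * exp \<bar>h * z\<bar>"
        using abs_exp_minus_1_le[of "h * z"] h by (simp add: abs_mult field_simps)
      also have "\<dots> \<le> \<bar>z\<bar> * exp (e * \<bar>z\<bar>)"
        using h by (intro mult_left_mono) (auto simp: abs_mult intro!: mult_right_mono)
      finally have "\<bar>?s h z\<bar> \<le> \<bar>z\<bar> ^ k * exp (t * z) * f z * (\<bar>z\<bar> * exp (e * \<bar>z\<bar>))"
        unfolding abs_mult using nonneg[of z]
        by (intro mult_mono) (auto simp: power_abs)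
      also have "\<dots> = \<bar>z\<bar> ^ Suc k * f z * (exp (t * z) * exp (e * \<bar>z\<bar>))"
        by simp
      also have "\<dots> \<le> \<bar>z\<bar> ^ Suc k * f z * (exp ((t - e) * z) + exp ((t + e) * z))"
        using nonneg[of z] e by (intro mult_left_mono exp_tilt_le) auto
      also have "\<dots> = ?w z"
        using nonneg[of z] by (simp add: abs_mult power_abs algebra_simps)
      finally show ?thesis .
    qed
  qed
  moreover have "\<forall>\<^sub>F h in at 0. (\<integral>z. ?s h z \<partial>lborel) =
      ((\<integral>z. z ^ k * exp ((t + h) * z) * f z \<partial>lborel) - (\<integral>z. z ^ k * exp (t * z) * f z \<partial>lborel)) / h"
    unfolding eventually_at
  proof (intro exI[of _ e] conjI ballI impI)
    fix h :: real assume h: "h \<noteq> 0 \<and> dist h 0 < e"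
    \<comment> \<open>Both integrals must exist before their difference can be written as one
      integral.\<close>
    then have "a < t + h" "t + h < b"
      using e by (auto simp: dist_real_def)
    then have "(\<integral>z. z ^ k * exp ((t + h) * z) * f z \<partial>lborel) - (\<integral>z. z ^ k * exp (t * z) * f z \<partial>lborel)
        = (\<integral>z. z ^ k * exp ((t + h) * z) * f z - z ^ k * exp (t * z) * f z \<partial>lborel)"
      using t by (intro Bochner_Integration.integral_diff[symmetric] int) auto
    also have "\<dots> = (\<integral>z. h * ?s h z \<partial>lborel)"
    proof (intro Bochner_Integration.integral_cong refl)
      fix z
      have e: "exp ((t + h) * z) = exp (t * z) * exp (h * z)"
        by (simp add: exp_add distrib_right)
      \<comment> \<open>Used with \<open>c = z ^ k * exp (t * z) * f z\<close> and
        \<open>x = exp (h * z)\<close>.\<close>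
      have "h * (c * ((x - 1) / h)) = c * x - c" for c x :: real
        using h by (simp add: field_simps)
      then have "h * ?s h z = z ^ k * exp (t * z) * f z * exp (h * z) - z ^ k * exp (t * z) * f z" .
      then show "z ^ k * exp ((t + h) * z) * f z - z ^ k * exp (t * z) * f z = h * ?s h z"
        unfolding e by (simp only: mult_ac)
    qed
    finally show "(\<integral>z. ?s h z \<partial>lborel) =
      ((\<integral>z. z ^ k * exp ((t + h) * z) * f z \<partial>lborel) - (\<integral>z. z ^ k * exp (t * z) * f z \<partial>lborel)) / h"
      using h by simp
  qed (use e in auto)
  ultimately show ?thesis
    unfolding DERIV_def by (rule Lim_transform_eventually)
qed

section \<open>Change of variables\<close>

text \<open>\<open>T\<close> is strictly increasing, hence injective with
  \<open>\<bar>T' z\<bar> = T' z\<close>, and its range carries all the mass of \<open>p\<close>.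
  The change of variables theorem then moves integrability and value together.\<close>

lemma has_bochner_integral_density_substitution:
  fixes p h f T T' :: "real \<Rightarrow> real"
  assumes deriv: "\<And>z. (T has_real_derivative T' z) (at z)" and pos: "\<And>z. 0 < T' z"
    and meas: "p \<in> borel_measurable borel" "h \<in> borel_measurable borel"
      "f \<in> borel_measurable borel"
    and nonneg: "\<And>x. 0 \<le> p x" and vanish: "\<And>x. x \<notin> range T \<Longrightarrow> p x = 0"
    and f: "\<And>z. T' z * p (T z) = f z"
    and int: "has_bochner_integral lborel (\<lambda>z. f z * h (T z)) b"
  shows "has_bochner_integral (density lborel (\<lambda>x. ennreal (p x))) h b"
proof -
  have T_less: "T x < T y" if "x < y" for x y
    using that by (rule DERIV_pos_imp_increasing) (use deriv pos in blast)
  then have inj: "inj T"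
    by (metis injI less_irrefl linorder_neqE_linordered_idom)
  have "continuous_on UNIV T"
    using deriv by (intro continuous_at_imp_continuous_on ballI) (rule DERIV_isCont)
  then have [measurable]: "T \<in> borel_measurable borel"
    by (rule borel_measurable_continuous_onI)
  note [measurable] = meas
  have eq: "\<bar>T' z\<bar> * (p (T z) * h (T z)) = f z * h (T z)" for z
    using f[of z] pos[of z] by (simp flip: mult.assoc)
  \<comment> \<open>The change of variables theorem speaks of absolute integrability with respect to
    the completed measure; Borel measurability allows passing from \<open>lborel\<close> to
    \<open>lebesgue\<close> here and back at the end.\<close>
  have "(\<lambda>z. f z * h (T z)) absolutely_integrable_on UNIV \<and>
      integral UNIV (\<lambda>z. f z * h (T z)) = b"
  proof -
    have "integrable lebesgue (\<lambda>z. f z * h (T z))" "integral\<^sup>L lebesgue (\<lambda>z. f z * h (T z)) = b"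
      using int by (simp_all add: integrable_completion integral_completion has_bochner_integral_iff)
    then show ?thesis
      using set_lebesgue_integral_eq_integral(2)[of UNIV "\<lambda>z. f z * h (T z)"]
      by (simp add: set_integrable_def set_lebesgue_integral_def)
  qed
  then have "(\<lambda>x. p x * h x) absolutely_integrable_on range T \<and> integral (range T) (\<lambda>x. p x * h x) = b"
    using has_absolute_integral_change_of_variables_1'[of UNIV T T' "\<lambda>x. p x * h x" b] deriv inj
    by (simp add: eq)
  moreover have ind: "indicat_real (range T) x *\<^sub>R (p x * h x) = p x * h x" for x
    using vanish[of x] by (auto simp: indicator_def)
  ultimately have "integrable lebesgue (\<lambda>x. p x * h x)" "integral\<^sup>L lebesgue (\<lambda>x. p x * h x) = b"
    using set_lebesgue_integral_eq_integral(2)[of "range T" "\<lambda>x. p x * h x"]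
    by (simp_all only: set_integrable_def set_lebesgue_integral_def ind)
  then have "has_bochner_integral lborel (\<lambda>x. p x * h x) b"
    by (simp add: has_bochner_integral_iff integrable_completion integral_completion)
  then show ?thesis
    using nonneg by (intro has_bochner_integral_density) auto
qed

section \<open>The score equation\<close>

text \<open>This is how the argument of \<open>f\<close> in the density depends on the shape near 0.
  The value is the linear coefficient in the expansion \<open>y - s * y\<^sup>2 / 2 + ...\<close> of
  the quotient.\<close>

lemma DERIV_ln_quotient_at_0:
  fixes y :: real
  shows "((\<lambda>s. if s = 0 then y else ln (1 + s * y) / s) has_real_derivative - (y\<^sup>2 / 2)) (at 0)"
proof -
  have pos: "\<forall>\<^sub>F s in at 0. 0 < 1 + s * y"
  proof -
    have "((\<lambda>s. 1 + s * y) \<longlongrightarrow> 1 + 0 * y) (at 0)"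
      by (intro tendsto_intros)
    then show ?thesis
      by (rule order_tendstoD) simp
  qed
  \<comment> \<open>The difference quotient at 0. One application of l'Hopital's rule suffices once
    the derivative of the numerator is written with an explicit factor \<open>s\<close>.\<close>
  have "((\<lambda>s. (ln (1 + s * y) - s * y) / s\<^sup>2) \<longlongrightarrow> - (y\<^sup>2 / 2)) (at 0)"
  proof (rule lhopital)
    show "((\<lambda>s. ln (1 + s * y) - s * y) \<longlongrightarrow> 0) (at 0)"
      by (auto intro!: tendsto_eq_intros)
    show "((\<lambda>s::real. s\<^sup>2) \<longlongrightarrow> 0) (at 0)"
      by (auto intro!: tendsto_eq_intros)
    show "\<forall>\<^sub>F s::real in at 0. s\<^sup>2 \<noteq> 0" "\<forall>\<^sub>F s::real in at 0. 2 * s \<noteq> 0"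
      by (auto simp: eventually_at_filter)
    show "\<forall>\<^sub>F s in at 0. ((\<lambda>s. ln (1 + s * y) - s * y) has_real_derivative
        (- (y\<^sup>2) / (1 + s * y)) * s) (at s)"
      using pos
    proof eventually_elim
      case (elim s)
      have "y / (1 + s * y) - y = (- (y\<^sup>2) / (1 + s * y)) * s"
        using elim by (simp add: field_simps power2_eq_square)
      moreover have "((\<lambda>s. ln (1 + s * y) - s * y) has_real_derivative y / (1 + s * y) - y) (at s)"
        using elim by (auto intro!: derivative_eq_intros)
      ultimately show ?case by simp
    qed
    show "\<forall>\<^sub>F s::real in at 0. ((\<lambda>s. s\<^sup>2) has_real_derivative 2 * s) (at s)"
      by (auto intro!: always_eventually derivative_eq_intros)
    have "((\<lambda>s. (- (y\<^sup>2) / (1 + s * y)) / 2) \<longlongrightarrow> - (y\<^sup>2 / 2)) (at 0)"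
      by (auto intro!: tendsto_eq_intros)
    then show "((\<lambda>s. (- (y\<^sup>2) / (1 + s * y)) * s / (2 * s)) \<longlongrightarrow> - (y\<^sup>2 / 2)) (at 0)"
      by (rule Lim_transform_eventually) (auto simp: eventually_at_filter)
  qed
  then show ?thesis
    unfolding DERIV_def
    by (rule Lim_transform_eventually) (auto simp: eventually_at_filter field_simps power2_eq_square)
qed

text \<open>The case \<open>\<mu> = 0\<close>, \<open>\<sigma> = 1\<close>, in which \<open>std_shape_grad \<xi>\<close> is the derivative of the shape score.\<close>

definition std_density :: "(real \<Rightarrow> real) \<Rightarrow> real \<Rightarrow> real \<Rightarrow> real" where
  "std_density f \<xi> y =
     (if \<xi> = 0 then f y
      else if 0 < 1 + \<xi> * y then inverse (1 + \<xi> * y) * f (ln (1 + \<xi> * y) / \<xi>) else 0)"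

definition std_shape_grad :: "real \<Rightarrow> real \<Rightarrow> real" where
  "std_shape_grad \<xi> y =
     (if \<xi> = 0 then y\<^sup>2 / 2 else ((1 + \<xi> * y) * ln (1 + \<xi> * y) - \<xi> * y) / \<xi>\<^sup>2)"

text \<open>Settles the positivity test in \<open>std_density\<close> on a whole neighbourhood, so
  that a single branch can be differentiated. It serves for the space variable and, with the factors
  exchanged, for the shape.\<close>

lemma eventually_pos_affine:
  fixes c y :: real
  assumes "0 < 1 + c * y"
  shows "\<forall>\<^sub>F z in nhds y. 0 < 1 + c * z"
proof -
  have "((\<lambda>z. 1 + c * z) \<longlongrightarrow> 1 + c * y) (nhds y)"
    by (intro tendsto_intros filterlim_ident)
  then show ?thesis
    using assms by (rule order_tendstoD)
qed

lemma std_density_deriv: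
  assumes f: "\<And>x. (f has_real_derivative f' x) (at x)" and y: "0 < 1 + \<xi> * y"
  shows "(std_density f \<xi> has_real_derivative
      (if \<xi> = 0 then f' y else (f' (ln (1 + \<xi> * y) / \<xi>) - \<xi> * f (ln (1 + \<xi> * y) / \<xi>)) / (1 + \<xi> * y)\<^sup>2))
      (at y)"
proof (cases "\<xi> = 0")
  case True
  then have "std_density f \<xi> = f"
    by (auto simp: std_density_def)
  then show ?thesis
    using True f by simp
next
  case False
  have inv: "((\<lambda>y. inverse (1 + \<xi> * y)) has_real_derivative - \<xi> / (1 + \<xi> * y)\<^sup>2) (at y)"
    using y by (auto intro!: derivative_eq_intros simp: divide_inverse power2_eq_square)
  have log: "((\<lambda>y. ln (1 + \<xi> * y) / \<xi>) has_real_derivative inverse (1 + \<xi> * y)) (at y)"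
    using y False by (auto intro!: derivative_eq_intros simp: divide_inverse)
  have "((\<lambda>y. inverse (1 + \<xi> * y) * f (ln (1 + \<xi> * y) / \<xi>)) has_real_derivative
      (f' (ln (1 + \<xi> * y) / \<xi>) - \<xi> * f (ln (1 + \<xi> * y) / \<xi>)) / (1 + \<xi> * y)\<^sup>2) (at y)"
    by (rule DERIV_cong[OF DERIV_mult[OF inv DERIV_chain2[OF f log]]])
      (simp add: right_diff_distrib divide_inverse power2_eq_square mult_ac)
  moreover have "\<forall>\<^sub>F z in nhds y. 0 < 1 + \<xi> * z"
    using eventually_pos_affine[OF y] .
  then have "\<forall>\<^sub>F z in nhds y. inverse (1 + \<xi> * z) * f (ln (1 + \<xi> * z) / \<xi>) = std_density f \<xi> z"
    by eventually_elim (simp add: std_density_def False)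
  ultimately show ?thesis
    using False by (simp cong: DERIV_cong_ev)
qed

text \<open>At \<open>\<xi> = 0\<close> the shape derivative crosses the case split in
  \<open>std_density\<close> and relies on \<open>DERIV_ln_quotient_at_0\<close>; at
  \<open>\<xi> \<noteq> 0\<close> both derivatives follow from product and chain rules and are
  compared algebraically.\<close>

lemma std_shape_equation:
  assumes f: "\<And>x. (f has_real_derivative f' x) (at x)" and y: "0 < 1 + \<xi> * y"
  shows "\<exists>d. ((\<lambda>s. std_density f (\<xi> + s) y) has_real_derivative d) (at 0) \<and>
    ((\<lambda>y. std_density f \<xi> y * std_shape_grad \<xi> y) has_real_derivative - d) (at y)"
proof (cases "\<xi> = 0")
  case True
  \<comment> \<open>With the removable singularity filled in,
    \<open>inverse (1 + s * y) * f (?g s)\<close> agrees with both branches of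
    \<open>std_density f s y\<close> for \<open>s\<close> near 0.\<close>
  let ?g = "\<lambda>s. if s = 0 then y else ln (1 + s * y) / s"
  have "((\<lambda>s. f (?g s)) has_real_derivative f' y * (- (y\<^sup>2 / 2))) (at 0)"
    by (rule DERIV_chain2[OF _ DERIV_ln_quotient_at_0]) (simp add: f)
  moreover have "((\<lambda>s. inverse (1 + s * y)) has_real_derivative - y) (at 0)"
    by (auto intro!: derivative_eq_intros)
  ultimately have "((\<lambda>s. inverse (1 + s * y) * f (?g s)) has_real_derivative
      - (y * f y) - y\<^sup>2 * f' y / 2) (at 0)"
    by (intro DERIV_cong[OF DERIV_mult]) auto
  moreover have "\<forall>\<^sub>F s in nhds 0. 0 < 1 + s * y"
    using eventually_pos_affine[of y 0] by (simp add: mult.commute)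
  then have "\<forall>\<^sub>F s in nhds 0. inverse (1 + s * y) * f (?g s) = std_density f s y"
    by eventually_elim (auto simp: std_density_def)
  ultimately have "((\<lambda>s. std_density f s y) has_real_derivative - (y * f y) - y\<^sup>2 * f' y / 2) (at 0)"
    by (simp cong: DERIV_cong_ev)
  moreover have "((\<lambda>y. f y * (y\<^sup>2 / 2)) has_real_derivative y * f y + y\<^sup>2 * f' y / 2) (at y)"
    by (rule DERIV_cong[OF DERIV_mult[OF f]]) (auto intro!: derivative_eq_intros)
  ultimately show ?thesis
    by (intro exI[of _ "- (y * f y) - y\<^sup>2 * f' y / 2"])
      (simp add: True std_density_def std_shape_grad_def add.commute)
next
  case False
  define t where "t = 1 + \<xi> * y"
  \<comment> \<open>The second fact eliminates \<open>y\<close> from the final identity, leaving an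
    algebraic one in \<open>t\<close>, \<open>ln t\<close>, \<open>F\<close> and
    \<open>F'\<close>.\<close>
  have t: "0 < t" "y = (t - 1) / \<xi>"
    using y False by (auto simp: t_def)
  define F F' where "F = f (ln t / \<xi>)" and "F' = f' (ln t / \<xi>)"
  define d where "d = - (y / t\<^sup>2) * F + (y / (t * \<xi>) - ln t / \<xi>\<^sup>2) / t * F'"
  have "((\<lambda>s. inverse (1 + s * y) * f (ln (1 + s * y) / s)) has_real_derivative d) (at \<xi>)"
  proof -
    have "((\<lambda>s. inverse (1 + s * y)) has_real_derivative - (y / t\<^sup>2)) (at \<xi>)"
      using t(1) by (auto intro!: derivative_eq_intros simp: t_def divide_inverse power2_eq_square)
    moreover have "((\<lambda>s. ln (1 + s * y) / s) has_real_derivative y / (t * \<xi>) - ln t / \<xi>\<^sup>2) (at \<xi>)"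
    proof -
      have "((\<lambda>s. ln (1 + s * y)) has_real_derivative y / t) (at \<xi>)"
        using t(1) by (auto intro!: derivative_eq_intros simp: t_def)
      from DERIV_divide[OF this DERIV_ident False] show ?thesis
        by (rule DERIV_cong) (use t(1) False in \<open>simp add: t_def[symmetric] field_simps power2_eq_square\<close>)
    qed
    ultimately show ?thesis
      by (intro DERIV_cong[OF DERIV_mult[OF _ DERIV_chain2[OF f]]])
        (auto simp: d_def F_def F'_def t_def divide_inverse)
  qed
  moreover have "\<forall>\<^sub>F s in nhds \<xi>. 0 < 1 + s * y"
    using eventually_pos_affine[of y \<xi>] y by (simp add: mult.commute)
  then have "\<forall>\<^sub>F s in nhds \<xi>. inverse (1 + s * y) * f (ln (1 + s * y) / s) = std_density f s y"
    \<comment> \<open>Keeps \<open>s\<close> away from 0, hence in the branch with nonzero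
      shape.\<close>
    using t1_space_nhds[OF False]
    by eventually_elim (auto simp: std_density_def)
  ultimately have "((\<lambda>s. std_density f s y) has_real_derivative d) (at \<xi>)"
    by (simp cong: DERIV_cong_ev)
  then have 1: "((\<lambda>s. std_density f (\<xi> + s) y) has_real_derivative d) (at 0)"
    using DERIV_shift[of "\<lambda>s. std_density f s y" d 0 \<xi>] by (simp add: add.commute)
  have "((\<lambda>y. ((1 + \<xi> * y) * ln (1 + \<xi> * y) - \<xi> * y) / \<xi>\<^sup>2) has_real_derivative ln t / \<xi>) (at y)"
  proof -
    have "((\<lambda>y. (1 + \<xi> * y) * ln (1 + \<xi> * y) - \<xi> * y) has_real_derivative \<xi> * ln t) (at y)"
      using t(1) by (auto intro!: derivative_eq_intros simp: t_def)
    then show ?thesis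
      by (rule DERIV_cong[OF DERIV_cdivide]) (use False in \<open>simp add: power2_eq_square\<close>)
  qed
  then have "(std_shape_grad \<xi> has_real_derivative ln t / \<xi>) (at y)"
    unfolding std_shape_grad_def using False by simp
  from DERIV_mult[OF std_density_deriv[OF f y] this]
  have "((\<lambda>y. std_density f \<xi> y * std_shape_grad \<xi> y) has_real_derivative
      (F' - \<xi> * F) / t\<^sup>2 * ((t * ln t - \<xi> * y) / \<xi>\<^sup>2) + ln t / \<xi> * (F / t)) (at y)"
    using False y by (simp add: std_density_def std_shape_grad_def F_def F'_def t_def divide_inverse mult_ac)
  moreover have "(F' - \<xi> * F) / t\<^sup>2 * ((t * ln t - \<xi> * y) / \<xi>\<^sup>2) + ln t / \<xi> * (F / t) = - d"
    unfolding d_def t(2) using False t(1) by (simp add: divide_simps power2_eq_square, simp add: algebra_simps)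
  ultimately show ?thesis
    using 1 by auto
qed

section \<open>Transport to the generating density\<close>

text \<open>The map \<open>T\<close> of the overview: if \<open>Z\<close> has density
  \<open>f\<close>, then \<open>lss_map \<theta> Z\<close> has the law of the model at
  \<open>\<theta>\<close>.\<close>

definition lss_map :: "real ^ 3 \<Rightarrow> real \<Rightarrow> real" where
  "lss_map \<theta> z = \<theta> $ 1 + \<theta> $ 2 * (if \<theta> $ 3 = 0 then z else (exp (\<theta> $ 3 * z) - 1) / \<theta> $ 3)"

text \<open>The \<open>i\<close>-th score derivative pulled back along \<open>lss_map\<close>. It is
  also the partial derivative of \<open>lss_map \<theta> z\<close> in the \<open>i\<close>-th
  parameter, that is, the velocity of the transported point; the information matrix is the Gram
  matrix of these velocities.\<close>

definition lss_grad :: "real \<Rightarrow> real \<Rightarrow> 3 \<Rightarrow> real \<Rightarrow> real" where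
  "lss_grad \<sigma> \<xi> i z =
     (if i = 1 then 1
      else if i = 2 then if \<xi> = 0 then z else (exp (\<xi> * z) - 1) / \<xi>
      else \<sigma> * (if \<xi> = 0 then z\<^sup>2 / 2 else (\<xi> * z * exp (\<xi> * z) - exp (\<xi> * z) + 1) / \<xi>\<^sup>2))"

definition lss_potential_deriv :: "real ^ 3 \<Rightarrow> 3 \<Rightarrow> real \<Rightarrow> real" where
  "lss_potential_deriv \<theta> i x =
     (let y = (x - \<theta> $ 1) / \<theta> $ 2 in
      if i = 1 then 1 else if i = 2 then y else \<theta> $ 2 * std_shape_grad (\<theta> $ 3) y)"

text \<open>Reduces the differential equations to location 0 and scale 1.\<close>

lemma lss_density_eq_std_density:
  "lss_density f \<theta> x = 1 / \<theta> $ 2 * std_density f (\<theta> $ 3) ((x - \<theta> $ 1) / \<theta> $ 2)"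
  by (simp add: lss_density_def std_density_def lss_domain_def lss_arg_def)

lemma lss_arg_map: "\<theta> $ 2 > 0 \<Longrightarrow> lss_arg \<theta> (lss_map \<theta> z) = exp (\<theta> $ 3 * z)"
  by (simp add: lss_arg_def lss_map_def)

lemma lss_map_in_domain: "\<theta> $ 2 > 0 \<Longrightarrow> lss_map \<theta> z \<in> lss_domain \<theta>"
  by (simp add: lss_domain_def lss_arg_map)

lemma range_lss_map:
  assumes "\<theta> $ 2 > 0"
  shows "range (lss_map \<theta>) = lss_domain \<theta>"
proof
  show "range (lss_map \<theta>) \<subseteq> lss_domain \<theta>"
    using lss_map_in_domain[OF assms] by auto
  show "lss_domain \<theta> \<subseteq> range (lss_map \<theta>)"
  proof
    fix x assume x: "x \<in> lss_domain \<theta>"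
    have "x = lss_map \<theta> (if \<theta> $ 3 = 0 then (x - \<theta> $ 1) / \<theta> $ 2 else ln (lss_arg \<theta> x) / \<theta> $ 3)"
      using assms x by (auto simp: lss_map_def lss_domain_def) (simp add: lss_arg_def)
    then show "x \<in> range (lss_map \<theta>)"
      by blast
  qed
qed

lemma lss_map_has_derivative:
  "(lss_map \<theta> has_real_derivative \<theta> $ 2 * exp (\<theta> $ 3 * z)) (at z)"
proof (cases "\<theta> $ 3 = 0")
  case True
  then show ?thesis
    unfolding lss_map_def by (auto intro!: derivative_eq_intros)
next
  case False
  then show ?thesis
    unfolding lss_map_def by (auto intro!: derivative_eq_intros)
qed

lemma lss_density_map:
  assumes "\<theta> $ 2 > 0"
  shows "\<theta> $ 2 * exp (\<theta> $ 3 * z) * lss_density f \<theta> (lss_map \<theta> z) = f z"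
proof (cases "\<theta> $ 3 = 0")
  case True
  then show ?thesis
    using assms by (simp add: lss_density_def lss_map_def)
next
  case False
  then show ?thesis
    using assms lss_map_in_domain[OF assms, of z]
    by (simp add: lss_density_def lss_arg_map)
qed

lemma lss_density_outside: "x \<notin> lss_domain \<theta> \<Longrightarrow> lss_density f \<theta> x = 0"
  by (cases "\<theta> $ 3 = 0") (simp_all add: lss_density_def lss_domain_def lss_arg_def)

lemma lss_density_nonneg:
  assumes "\<And>z. 0 \<le> f z" "\<theta> $ 2 > 0"
  shows "0 \<le> lss_density f \<theta> x"
  using assms by (simp add: lss_density_def lss_domain_def)

lemma open_lss_domain: "\<theta> $ 2 > 0 \<Longrightarrow> open (lss_domain \<theta>)"
  unfolding lss_domain_def lss_arg_def
  by (intro open_Collect_less continuous_intros) auto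

lemma measurable_lss_arg [measurable]: "lss_arg \<theta> \<in> borel_measurable borel"
  unfolding lss_arg_def by measurable

lemma measurable_lss_density:
  assumes [measurable]: "f \<in> borel_measurable borel"
  shows "lss_density f \<theta> \<in> borel_measurable borel"
  unfolding lss_density_def lss_domain_def by (cases "\<theta> $ 3 = 0") simp_all

lemma measurable_lss_potential: "lss_potential \<theta> i \<in> borel_measurable borel"
  unfolding lss_potential_def Let_def
  by (cases "i = 1"; cases "i = 2"; cases "\<theta> $ 3 = 0") simp_all

text \<open>All expectations under the model go through this rule. Only the values of
  \<open>h\<close> on \<open>lss_domain \<theta>\<close> enter, because that set is the range of
  \<open>lss_map \<theta>\<close>.\<close>

lemma has_bochner_integral_law:
  assumes nonneg: "\<And>z. 0 \<le> f z" and meas: "f \<in> borel_measurable borel" "h \<in> borel_measurable borel"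
    and \<sigma>: "\<theta> $ 2 > 0"
    and int: "has_bochner_integral lborel (\<lambda>z. f z * h (lss_map \<theta> z)) b"
  shows "has_bochner_integral (law (lss_density f) \<theta>) h b"
  unfolding law_def
proof (rule has_bochner_integral_density_substitution[OF lss_map_has_derivative])
  show "lss_density f \<theta> x = 0" if "x \<notin> range (lss_map \<theta>)" for x
    using that lss_density_outside by (simp add: range_lss_map[OF \<sigma>])
qed (use assms in \<open>auto simp: lss_density_map lss_density_nonneg measurable_lss_density\<close>)

lemma lss_potential_has_derivative:
  assumes \<sigma>: "\<theta> $ 2 > 0" and x: "x \<in> lss_domain \<theta>"
  shows "(lss_potential \<theta> i has_real_derivative lss_potential_deriv \<theta> i x) (at x)"
proof -
  define t where "t = lss_arg \<theta> x"
  have t: "0 < t"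
    using x by (simp add: t_def lss_domain_def)
  consider "i = 1" | "i = 2" | "i = 3" "\<theta> $ 3 = 0" | "i = 3" "\<theta> $ 3 \<noteq> 0"
    using exhaust_3[of i] by blast
  then show ?thesis
  proof cases
    case 1
    then show ?thesis
      unfolding lss_potential_def lss_potential_deriv_def Let_def by simp
  next
    case 2
    then have "lss_potential \<theta> i = (\<lambda>x. (x - \<theta> $ 1)\<^sup>2 / (2 * \<theta> $ 2))"
      by (simp add: lss_potential_def Let_def fun_eq_iff)
    with 2 \<sigma> show ?thesis
      unfolding lss_potential_deriv_def Let_def
      by (auto intro!: derivative_eq_intros simp: field_simps)
  next
    case 3
    then have "lss_potential \<theta> i = (\<lambda>x. (\<theta> $ 2)\<^sup>2 / 6 * ((x - \<theta> $ 1) / \<theta> $ 2) ^ 3)"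
      by (simp add: lss_potential_def Let_def fun_eq_iff)
    with 3 \<sigma> show ?thesis
      unfolding lss_potential_deriv_def Let_def std_shape_grad_def
      by (auto intro!: derivative_eq_intros simp: power2_eq_square)
  next
    case 4
    let ?g = "\<lambda>t. (\<theta> $ 2)\<^sup>2 / (\<theta> $ 3) ^ 3 * (1 / 2 * t\<^sup>2 * ln t - 3 / 4 * t\<^sup>2 + t)"
    have arg: "(lss_arg \<theta> has_real_derivative \<theta> $ 3 / \<theta> $ 2) (at x)"
      unfolding lss_arg_def using \<sigma> by (auto intro!: derivative_eq_intros)
    have g: "(?g has_real_derivative (\<theta> $ 2)\<^sup>2 / (\<theta> $ 3) ^ 3 * (t * ln t - t + 1)) (at t)"
    proof (rule DERIV_cmult)
      show "((\<lambda>t. 1 / 2 * t\<^sup>2 * ln t - 3 / 4 * t\<^sup>2 + t) has_real_derivative t * ln t - t + 1) (at t)"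
        using t by (auto intro!: derivative_eq_intros simp: power2_eq_square field_simps)
    qed
    have "((\<lambda>x. ?g (lss_arg \<theta> x)) has_real_derivative
        (\<theta> $ 2)\<^sup>2 / (\<theta> $ 3) ^ 3 * (t * ln t - t + 1) * (\<theta> $ 3 / \<theta> $ 2)) (at x)"
      by (rule DERIV_chain2[OF g[unfolded t_def] arg, folded t_def])
    moreover have "lss_potential \<theta> i = (\<lambda>x. ?g (lss_arg \<theta> x))"
      using 4 by (simp add: lss_potential_def Let_def fun_eq_iff)
    moreover have "(\<theta> $ 2)\<^sup>2 / (\<theta> $ 3) ^ 3 * (t * ln t - t + 1) * (\<theta> $ 3 / \<theta> $ 2) =
        lss_potential_deriv \<theta> i x"
    proof -
      \<comment> \<open>With these, \<open>t * ln t - t + 1\<close> is the numerator of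
        \<open>std_shape_grad\<close>, and the inner derivative
        \<open>\<theta> $ 3 / \<theta> $ 2\<close> lowers the prefactor to scale over shape
        squared.\<close>
      have "\<theta> $ 3 * ((x - \<theta> $ 1) / \<theta> $ 2) = t - 1" "1 + \<theta> $ 3 * ((x - \<theta> $ 1) / \<theta> $ 2) = t"
        by (simp_all add: t_def lss_arg_def)
      then show ?thesis
        using 4 \<sigma> by (simp add: lss_potential_deriv_def Let_def std_shape_grad_def
            power2_eq_square power3_eq_cube)
    qed
    ultimately show ?thesis
      by simp
  qed
qed

lemma lss_potential_deriv_map:
  assumes \<sigma>: "\<theta> $ 2 > 0"
  shows "lss_potential_deriv \<theta> i (lss_map \<theta> z) = lss_grad (\<theta> $ 2) (\<theta> $ 3) i z"
proof -
  have y: "(lss_map \<theta> z - \<theta> $ 1) / \<theta> $ 2 = (if \<theta> $ 3 = 0 then z else (exp (\<theta> $ 3 * z) - 1) / \<theta> $ 3)"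
    using \<sigma> by (simp add: lss_map_def)
  show ?thesis
    unfolding lss_potential_deriv_def Let_def y lss_grad_def std_shape_grad_def
    by (simp add: diff_diff_eq2 mult_ac)
qed

lemma lss_score_has_derivative:
  assumes "\<theta> $ 2 > 0" "x \<in> lss_domain \<theta>"
  shows "(lss_score f \<theta> i has_real_derivative lss_potential_deriv \<theta> i x) (at x)"
proof -
  let ?c = "\<integral>y. lss_potential \<theta> i y \<partial>law (lss_density f) \<theta>"
  have "((\<lambda>x. lss_potential \<theta> i x - ?c) has_real_derivative lss_potential_deriv \<theta> i x - 0) (at x)"
    by (intro DERIV_diff lss_potential_has_derivative assms DERIV_const)
  \<comment> \<open>The domain is open, so the value 0 outside it is invisible near
    \<open>x\<close>.\<close>
  moreover have "\<forall>\<^sub>F y in nhds x. lss_potential \<theta> i y - ?c = lss_score f \<theta> i y"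
    using eventually_nhds_in_open[OF open_lss_domain[OF assms(1)] assms(2)]
    by eventually_elim (simp add: lss_score_def)
  ultimately show ?thesis
    by (simp cong: DERIV_cong_ev)
qed

lemma deriv_lss_score:
  assumes "\<theta> $ 2 > 0" "x \<in> lss_domain \<theta>"
  shows "deriv (lss_score f \<theta> i) x = lss_potential_deriv \<theta> i x"
  using lss_score_has_derivative[OF assms] by (rule DERIV_imp_deriv)

lemma measurable_lss_score: "\<theta> $ 2 > 0 \<Longrightarrow> lss_score f \<theta> i \<in> borel_measurable borel"
  unfolding lss_score_def lss_domain_def
  using measurable_lss_potential[of \<theta> i, measurable] by simp

lemma measurable_lss_potential_deriv: "lss_potential_deriv \<theta> i \<in> borel_measurable borel"
  unfolding lss_potential_deriv_def Let_def std_shape_grad_def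
  by (cases "i = 1"; cases "i = 2"; cases "\<theta> $ 3 = 0") simp_all

text \<open>The score may fail to be differentiable at the endpoint of the domain, where \<^const>\<open>deriv\<close>
  returns an arbitrary value.\<close>

lemma measurable_deriv_lss_score:
  assumes \<sigma>: "\<theta> $ 2 > 0"
  shows "deriv (lss_score f \<theta> i) \<in> borel_measurable borel"
proof -
  have 0: "deriv (lss_score f \<theta> i) x = 0" if x: "lss_arg \<theta> x < 0" for x
  proof -
    have "open {x. lss_arg \<theta> x < 0}"
      unfolding lss_arg_def using \<sigma> by (intro open_Collect_less continuous_intros) auto
    then have "\<forall>\<^sub>F y in nhds x. y \<in> {x. lss_arg \<theta> x < 0}"
      using x by (intro eventually_nhds_in_open) auto
    then have "\<forall>\<^sub>F y in nhds x. 0 = lss_score f \<theta> i y"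
      by eventually_elim (simp add: lss_score_def lss_domain_def)
    moreover have "((\<lambda>y. 0) has_real_derivative 0) (at x)"
      by simp
    ultimately have "(lss_score f \<theta> i has_real_derivative 0) (at x)"
      by (simp cong: DERIV_cong_ev)
    then show ?thesis
      by (rule DERIV_imp_deriv)
  qed
  \<comment> \<open>The boundary is at most one point, so whatever \<open>deriv\<close> returns
    there is a constant on that piece. For \<open>\<theta> $ 3 = 0\<close> there is no boundary and
    the last branch below is never reached.\<close>
  have edge: "x = \<theta> $ 1 - \<theta> $ 2 / \<theta> $ 3" if "lss_arg \<theta> x = 0" for x
    using that \<sigma> by (cases "\<theta> $ 3 = 0") (auto simp: lss_arg_def field_simps)
  let ?e = "\<theta> $ 1 - \<theta> $ 2 / \<theta> $ 3"
  have "deriv (lss_score f \<theta> i) = (\<lambda>x. if 0 < lss_arg \<theta> x then lss_potential_deriv \<theta> i x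
      else if lss_arg \<theta> x < 0 then 0 else deriv (lss_score f \<theta> i) ?e)"
  proof (rule ext)
    fix x
    show "deriv (lss_score f \<theta> i) x = (if 0 < lss_arg \<theta> x then lss_potential_deriv \<theta> i x
      else if lss_arg \<theta> x < 0 then 0 else deriv (lss_score f \<theta> i) ?e)"
      using deriv_lss_score[OF \<sigma>, of x f i] 0[of x] edge[of x]
      by (auto simp: lss_domain_def not_less)
  qed
  also have "\<dots> \<in> borel_measurable borel"
    using measurable_lss_potential_deriv[of \<theta> i, measurable] by simp
  finally show ?thesis .
qed

text \<open>For location and scale only the chain rule for the standardised density is involved; the
  shape equation is \<open>std_shape_equation\<close> rescaled.\<close>

lemma lss_score_equation:
  assumes f: "\<And>x. (f has_real_derivative f' x) (at x)"
    and \<sigma>: "\<theta> $ 2 > 0" and x: "x \<in> lss_domain \<theta>"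
  shows "\<exists>d. ((\<lambda>s. lss_density f (\<theta> + s *\<^sub>R axis i 1) x) has_real_derivative d) (at 0) \<and>
    ((\<lambda>y. lss_density f \<theta> y * deriv (lss_score f \<theta> i) y) has_real_derivative - d) (at x)"
proof -
  define \<mu> \<sigma> \<xi> where "\<mu> = \<theta> $ 1" and "\<sigma> = \<theta> $ 2" and "\<xi> = \<theta> $ 3"
  define y where "y = (x - \<mu>) / \<sigma>"
  have \<sigma>_pos: "0 < \<sigma>" and y: "0 < 1 + \<xi> * y"
    using \<sigma> x by (simp_all add: \<sigma>_def \<xi>_def y_def \<mu>_def lss_domain_def lss_arg_def)
  obtain q' where q: "(std_density f \<xi> has_real_derivative q') (at y)"
    using std_density_deriv[OF f y] by blast
  have Y: "((\<lambda>x. (x - \<mu>) / \<sigma>) has_real_derivative 1 / \<sigma>) (at x)"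
    using \<sigma>_pos by (auto intro!: derivative_eq_intros)
  \<comment> \<open>The equation is first solved with the explicit derivative; \<open>ev\<close>
    then replaces it by \<open>deriv\<close>, with which it agrees near \<open>x\<close>.\<close>
  have eq: "\<exists>d. ((\<lambda>s. lss_density f (\<theta> + s *\<^sub>R axis i 1) x) has_real_derivative d) (at 0) \<and>
    ((\<lambda>y. lss_density f \<theta> y * lss_potential_deriv \<theta> i y) has_real_derivative - d) (at x)"
  proof -
    consider "i = 1" | "i = 2" | "i = 3"
      using exhaust_3[of i] by blast
    then show ?thesis
    proof cases
      case 1
      have "((\<lambda>s. (x - (\<mu> + s)) / \<sigma>) has_real_derivative - (1 / \<sigma>)) (at 0)"
        using \<sigma>_pos by (auto intro!: derivative_eq_intros)
      then have "((\<lambda>s. std_density f \<xi> ((x - (\<mu> + s)) / \<sigma>)) has_real_derivative q' * - (1 / \<sigma>)) (at 0)"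
        using q by (intro DERIV_chain2) (auto simp: y_def)
      then have "((\<lambda>s. 1 / \<sigma> * std_density f \<xi> ((x - (\<mu> + s)) / \<sigma>)) has_real_derivative
          1 / \<sigma> * (q' * - (1 / \<sigma>))) (at 0)"
        by (rule DERIV_cmult)
      moreover have "((\<lambda>x. 1 / \<sigma> * std_density f \<xi> ((x - \<mu>) / \<sigma>)) has_real_derivative
          1 / \<sigma> * (q' * (1 / \<sigma>))) (at x)"
        using q Y by (intro DERIV_cmult DERIV_chain2) (auto simp: y_def)
      ultimately show ?thesis
        using 1 by (intro exI[of _ "1 / \<sigma> * (q' * - (1 / \<sigma>))"])
          (simp add: lss_density_eq_std_density lss_potential_deriv_def axis_def
            \<mu>_def[symmetric] \<sigma>_def[symmetric] \<xi>_def[symmetric])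
    next
      case 2
      have "((\<lambda>s. (x - \<mu>) / (\<sigma> + s)) has_real_derivative - (y / \<sigma>)) (at 0)"
        using \<sigma>_pos by (auto intro!: derivative_eq_intros simp: y_def field_simps)
      then have "((\<lambda>s. std_density f \<xi> ((x - \<mu>) / (\<sigma> + s))) has_real_derivative q' * - (y / \<sigma>)) (at 0)"
        using q by (intro DERIV_chain2) (auto simp: y_def)
      moreover have "((\<lambda>s. 1 / (\<sigma> + s)) has_real_derivative - (1 / \<sigma>\<^sup>2)) (at 0)"
        using \<sigma>_pos by (auto intro!: derivative_eq_intros simp: power2_eq_square)
      ultimately have 3: "((\<lambda>s. 1 / (\<sigma> + s) * std_density f \<xi> ((x - \<mu>) / (\<sigma> + s))) has_real_derivative
          - (1 / \<sigma>\<^sup>2) * (std_density f \<xi> y + q' * y)) (at 0)"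
        by (intro DERIV_cong[OF DERIV_mult])
          (auto simp: y_def[symmetric] power2_eq_square add_divide_distrib distrib_left)
      have "((\<lambda>x. std_density f \<xi> ((x - \<mu>) / \<sigma>)) has_real_derivative q' * (1 / \<sigma>)) (at x)"
        using q Y by (intro DERIV_chain2) (auto simp: y_def)
      then have "((\<lambda>x. 1 / \<sigma> * (std_density f \<xi> ((x - \<mu>) / \<sigma>) * ((x - \<mu>) / \<sigma>))) has_real_derivative
          1 / \<sigma> * (q' * (1 / \<sigma>) * ((x - \<mu>) / \<sigma>) + 1 / \<sigma> * std_density f \<xi> ((x - \<mu>) / \<sigma>))) (at x)"
        using Y by (intro DERIV_cmult DERIV_mult)
      moreover have "1 / \<sigma> * (q' * (1 / \<sigma>) * ((x - \<mu>) / \<sigma>) + 1 / \<sigma> * std_density f \<xi> ((x - \<mu>) / \<sigma>)) =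
          1 / \<sigma>\<^sup>2 * (std_density f \<xi> y + q' * y)"
        by (simp add: y_def[symmetric] power2_eq_square distrib_left add.commute)
      ultimately have "((\<lambda>x. 1 / \<sigma> * std_density f \<xi> ((x - \<mu>) / \<sigma>) * ((x - \<mu>) / \<sigma>)) has_real_derivative
          1 / \<sigma>\<^sup>2 * (std_density f \<xi> y + q' * y)) (at x)"
        by (simp only: mult.assoc)
      then show ?thesis
        using 2 3 by (intro exI[of _ "- (1 / \<sigma>\<^sup>2) * (std_density f \<xi> y + q' * y)"])
          (simp add: lss_density_eq_std_density lss_potential_deriv_def axis_def
            \<mu>_def[symmetric] \<sigma>_def[symmetric] \<xi>_def[symmetric])
    next
      case 3
      obtain d where d: "((\<lambda>s. std_density f (\<xi> + s) y) has_real_derivative d) (at 0)"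
        "((\<lambda>y. std_density f \<xi> y * std_shape_grad \<xi> y) has_real_derivative - d) (at y)"
        using std_shape_equation[OF f y] by blast
      have "((\<lambda>s. 1 / \<sigma> * std_density f (\<xi> + s) y) has_real_derivative 1 / \<sigma> * d) (at 0)"
        by (intro DERIV_cmult d)
      \<comment> \<open>The factor \<sigma> in \<open>lss_potential_deriv\<close> cancels the
        normalisation \<open>1 / \<sigma>\<close> of the density, so neither appears in this
        product.\<close>
      moreover have "((\<lambda>x. std_density f \<xi> ((x - \<mu>) / \<sigma>) * std_shape_grad \<xi> ((x - \<mu>) / \<sigma>))
          has_real_derivative - d * (1 / \<sigma>)) (at x)"
        using d(2) Y unfolding y_def by (rule DERIV_chain2)
      ultimately show ?thesis
        using 3 \<sigma>_pos by (intro exI[of _ "1 / \<sigma> * d"])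
          (simp add: lss_density_eq_std_density lss_potential_deriv_def axis_def Let_def
            \<mu>_def[symmetric] \<sigma>_def[symmetric] \<xi>_def[symmetric] y_def[symmetric])
    qed
  qed
  have ev: "\<forall>\<^sub>F y in nhds x. lss_density f \<theta> y * deriv (lss_score f \<theta> i) y =
      lss_density f \<theta> y * lss_potential_deriv \<theta> i y"
    using eventually_nhds_in_open[OF open_lss_domain[OF \<sigma>] x]
    by eventually_elim (simp add: deriv_lss_score[OF \<sigma>])
  show ?thesis
    using eq by (simp only: DERIV_cong_ev[OF refl ev refl])
qed

section \<open>Moments of the score derivatives\<close>

text \<open>Openness gives room around both 0 and \<xi>; doubling the outermost points of the two
  neighbourhoods encloses 0 and \<open>2 * \<xi>\<close> strictly.\<close>

lemma exponent_interval:
  assumes "open \<Xi>" "0 \<in> \<Xi>" "\<xi> \<in> \<Xi>"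
    and fin: "\<forall>t \<in> {2 * \<xi> | \<xi>. \<xi> \<in> \<Xi>}. mgf_finite f t"
  obtains a b where "mgf_finite f a" "mgf_finite f b" "a < 0" "0 < b" "a < 2 * \<xi>" "2 * \<xi> < b"
proof -
  obtain d e where d: "0 < d" "cball 0 d \<subseteq> \<Xi>" and e: "0 < e" "cball \<xi> e \<subseteq> \<Xi>"
    using assms by (meson open_contains_cball)
  have *: "mgf_finite f (2 * x)" if "x \<in> \<Xi>" for x
    using fin that by blast
  have "- d \<in> \<Xi>" "d \<in> \<Xi>" "\<xi> - e \<in> \<Xi>" "\<xi> + e \<in> \<Xi>"
    using d e by (auto simp: subset_iff dist_real_def)
  \<comment> \<open>Each of the two is one of the four points above, so it lies in \<Xi> even if
    \<Xi> is disconnected.\<close>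
  then have "min (- d) (\<xi> - e) \<in> \<Xi>" "max d (\<xi> + e) \<in> \<Xi>"
    by (simp_all add: min_def max_def)
  then have "mgf_finite f (2 * min (- d) (\<xi> - e))" "mgf_finite f (2 * max d (\<xi> + e))"
    by - (rule *, assumption)+
  then show ?thesis
    by (rule that) (use d e in auto)
qed

text \<open>Finiteness is recorded only at two rates of opposite sign;
  \<open>integrable_exp_moment\<close> supplies every rate strictly between them.\<close>

locale exp_moments =
  fixes f :: "real \<Rightarrow> real" and a b :: real
  assumes density: "prob_density f"
    and fin: "mgf_finite f a" "mgf_finite f b" and ab: "a < 0" "0 < b"
begin

lemma nonneg: "0 \<le> f z"
  using density by (simp add: prob_density_def)

lemma meas [measurable]: "f \<in> borel_measurable borel"
  using density by (auto simp: prob_density_def dest: borel_measurable_has_bochner_integral)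

text \<open>On \<open>(a, b)\<close> this is the \<open>k\<close>-th derivative of
  \<open>mgf f\<close>; the case \<open>k = 0\<close> is \<open>mgf f\<close> itself.\<close>

definition moment :: "nat \<Rightarrow> real \<Rightarrow> real" where
  "moment k t = (\<integral>z. z ^ k * exp (t * z) * f z \<partial>lborel)"

lemma has_moment:
  assumes "a < t" "t < b"
  shows "has_bochner_integral lborel (\<lambda>z. z ^ k * exp (t * z) * f z) (moment k t)"
  unfolding moment_def
  by (intro has_bochner_integral_integrable integrable_exp_moment[OF nonneg meas fin] assms)

lemma moment_0_0: "moment 0 0 = 1"
  using density by (simp add: moment_def prob_density_def has_bochner_integral_iff)

lemma mgf_eq_moment: "mgf f = moment 0"
  by (simp add: fun_eq_iff mgf_def moment_def)

lemma deriv_moment: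
  assumes "a < t" "t < b"
  shows "deriv (moment k) t = moment (Suc k) t"
  unfolding moment_def
  by (intro DERIV_imp_deriv has_real_derivative_exp_moment[OF nonneg meas fin] assms)

lemma deriv_mgf: "a < t \<Longrightarrow> t < b \<Longrightarrow> deriv (mgf f) t = moment 1 t"
  by (simp add: mgf_eq_moment deriv_moment)

lemma deriv_deriv_mgf:
  assumes t: "a < t" "t < b"
  shows "deriv (deriv (mgf f)) t = moment 2 t"
proof -
  \<comment> \<open>The first derivative is identified with \<open>moment 1\<close> only on
    \<open>(a, b)\<close>, so the second is computed on a neighbourhood of \<open>t\<close>.\<close>
  have "\<forall>\<^sub>F s in nhds t. s \<in> {a<..<b}"
    using t by (intro eventually_nhds_in_open) auto
  then have "\<forall>\<^sub>F s in nhds t. deriv (mgf f) s = moment 1 s"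
    by eventually_elim (simp add: deriv_mgf)
  then have "deriv (deriv (mgf f)) t = deriv (moment 1) t"
    by (intro deriv_cong_ev) auto
  then show ?thesis
    using t by (simp add: deriv_moment numeral_2_eq_2)
qed

text \<open>Each product of two gradients expands into terms \<open>z ^ k * exp (c * z)\<close> with
  rates 0, \<xi> and \<open>2 * \<xi>\<close>, whose integrals against \<open>f\<close> are moments.
  Symmetry leaves six entries.\<close>

lemma has_bochner_integral_lss_grad:
  assumes \<xi>: "\<xi> \<noteq> 0" "a < 2 * \<xi>" "2 * \<xi> < b"
  shows "has_bochner_integral lborel (\<lambda>z. f z * (lss_grad \<sigma> \<xi> i z * lss_grad \<sigma> \<xi> j z))
    (lss_information_formula (mgf f) \<sigma> \<xi> $ i $ j)"
proof -
  have \<xi>': "a < \<xi>" "\<xi> < b"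
    using \<xi> ab by linarith+
  let ?m = "\<lambda>k t z. z ^ k * exp (t * z) * f z"
  note m = has_moment[OF ab] has_moment[OF \<xi>'] has_moment[OF \<xi>(2,3)]
  note intros = has_bochner_integral_add has_bochner_integral_diff has_bochner_integral_mult_right m
  have sq: "exp (2 * \<xi> * z) = exp (\<xi> * z) * exp (\<xi> * z)" for z
    by (simp flip: exp_add)
  have upper: "has_bochner_integral lborel (\<lambda>z. f z * (lss_grad \<sigma> \<xi> i z * lss_grad \<sigma> \<xi> j z))
      (lss_information_formula (mgf f) \<sigma> \<xi> $ i $ j)"
    if "(i, j) \<in> {(1, 1), (1, 2), (1, 3), (2, 2), (2, 3), (3, 3)}" for i j
  proof -
    \<comment> \<open>The right sides copy the shape of the closed form, with constants written as
      \<open>?m 0 0\<close>, so that integration proceeds term by term;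
      \<open>moment 0 0 = 1\<close> restores the constants afterwards.\<close>
    have eq:
      "f z * (lss_grad \<sigma> \<xi> 1 z * lss_grad \<sigma> \<xi> 1 z) =
        ?m 0 0 z"
      "f z * (lss_grad \<sigma> \<xi> 1 z * lss_grad \<sigma> \<xi> 2 z) =
        1 / \<xi> * (?m 0 \<xi> z - ?m 0 0 z)"
      "f z * (lss_grad \<sigma> \<xi> 1 z * lss_grad \<sigma> \<xi> 3 z) =
        \<sigma> / \<xi>\<^sup>2 * (\<xi> * ?m 1 \<xi> z - ?m 0 \<xi> z + ?m 0 0 z)"
      "f z * (lss_grad \<sigma> \<xi> 2 z * lss_grad \<sigma> \<xi> 2 z) =
        1 / \<xi>\<^sup>2 * (?m 0 (2 * \<xi>) z - 2 * ?m 0 \<xi> z + ?m 0 0 z)"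
      "f z * (lss_grad \<sigma> \<xi> 2 z * lss_grad \<sigma> \<xi> 3 z) =
        \<sigma> / \<xi> ^ 3 * (\<xi> * ?m 1 (2 * \<xi>) z - \<xi> * ?m 1 \<xi> z - ?m 0 (2 * \<xi>) z
          + 2 * ?m 0 \<xi> z - ?m 0 0 z)"
      "f z * (lss_grad \<sigma> \<xi> 3 z * lss_grad \<sigma> \<xi> 3 z) =
        \<sigma>\<^sup>2 / \<xi> ^ 4 * (\<xi>\<^sup>2 * ?m 2 (2 * \<xi>) z - 2 * \<xi> * ?m 1 (2 * \<xi>) z + 2 * \<xi> * ?m 1 \<xi> z
          + ?m 0 (2 * \<xi>) z - 2 * ?m 0 \<xi> z + ?m 0 0 z)" for z
      unfolding lss_grad_def sq
      using \<xi>(1) by (simp_all add: field_simps power2_eq_square power3_eq_cube power4_eq_xxxx)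
    have
      "has_bochner_integral lborel (\<lambda>z. f z * (lss_grad \<sigma> \<xi> 1 z * lss_grad \<sigma> \<xi> 1 z))
        (moment 0 0)"
      "has_bochner_integral lborel (\<lambda>z. f z * (lss_grad \<sigma> \<xi> 1 z * lss_grad \<sigma> \<xi> 2 z))
        (1 / \<xi> * (moment 0 \<xi> - moment 0 0))"
      "has_bochner_integral lborel (\<lambda>z. f z * (lss_grad \<sigma> \<xi> 1 z * lss_grad \<sigma> \<xi> 3 z))
        (\<sigma> / \<xi>\<^sup>2 * (\<xi> * moment 1 \<xi> - moment 0 \<xi> + moment 0 0))"
      "has_bochner_integral lborel (\<lambda>z. f z * (lss_grad \<sigma> \<xi> 2 z * lss_grad \<sigma> \<xi> 2 z))
        (1 / \<xi>\<^sup>2 * (moment 0 (2 * \<xi>) - 2 * moment 0 \<xi> + moment 0 0))"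
      "has_bochner_integral lborel (\<lambda>z. f z * (lss_grad \<sigma> \<xi> 2 z * lss_grad \<sigma> \<xi> 3 z))
        (\<sigma> / \<xi> ^ 3 * (\<xi> * moment 1 (2 * \<xi>) - \<xi> * moment 1 \<xi> - moment 0 (2 * \<xi>)
          + 2 * moment 0 \<xi> - moment 0 0))"
      "has_bochner_integral lborel (\<lambda>z. f z * (lss_grad \<sigma> \<xi> 3 z * lss_grad \<sigma> \<xi> 3 z))
        (\<sigma>\<^sup>2 / \<xi> ^ 4 * (\<xi>\<^sup>2 * moment 2 (2 * \<xi>) - 2 * \<xi> * moment 1 (2 * \<xi>) + 2 * \<xi> * moment 1 \<xi>
          + moment 0 (2 * \<xi>) - 2 * moment 0 \<xi> + moment 0 0))"
      unfolding eq by (intro intros)+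
    then show ?thesis
      using that \<xi> \<xi>' unfolding lss_information_formula_def Let_def
      by (auto simp: mgf_eq_moment moment_0_0 deriv_moment deriv_deriv_mgf[unfolded mgf_eq_moment])
  qed
  have sym: "lss_information_formula (mgf f) \<sigma> \<xi> $ i $ j = lss_information_formula (mgf f) \<sigma> \<xi> $ j $ i"
    for i j
    using exhaust_3[of i] exhaust_3[of j] by (auto simp: lss_information_formula_def Let_def)
  consider "(i, j) \<in> {(1, 1), (1, 2), (1, 3), (2, 2), (2, 3), (3, 3)}"
    | "(j, i) \<in> {(1, 1), (1, 2), (1, 3), (2, 2), (2, 3), (3, 3)}"
    using exhaust_3[of i] exhaust_3[of j] by auto
  then show ?thesis
  proof cases
    case 1
    then show ?thesis by (rule upper)
  next
    case 2
    then show ?thesis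
      using upper[OF 2] by (simp add: sym[of i j] mult.commute[of "lss_grad \<sigma> \<xi> i _"])
  qed
qed

text \<open>Along \<open>lss_map\<close> the logarithm of \<open>lss_arg\<close> becomes
  \<open>\<xi> * z\<close>, so the potentials also turn into combinations of exponential moments, or
  of plain moments when \<open>\<xi> = 0\<close>.\<close>

lemma integrable_lss_potential:
  assumes \<sigma>: "\<theta> $ 2 > 0" and \<xi>: "a < 2 * \<theta> $ 3" "2 * \<theta> $ 3 < b"
  shows "integrable lborel (\<lambda>z. f z * lss_potential \<theta> i (lss_map \<theta> z))"
proof -
  define \<mu> \<sigma> \<xi> where "\<mu> = \<theta> $ 1" and "\<sigma> = \<theta> $ 2" and "\<xi> = \<theta> $ 3"
  note defs = \<mu>_def[symmetric] \<sigma>_def[symmetric] \<xi>_def[symmetric]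
  have \<sigma>_pos: "0 < \<sigma>"
    using \<sigma> by (simp add: \<sigma>_def)
  have \<xi>2: "a < 2 * \<xi>" "2 * \<xi> < b"
    using \<xi> by (simp_all add: \<xi>_def)
  then have \<xi>1: "a < \<xi>" "\<xi> < b"
    using ab by linarith+
  let ?m = "\<lambda>k t z. z ^ k * exp (t * z) * f z"
  note m = has_moment[OF ab, THEN integrable.intros] has_moment[OF \<xi>1, THEN integrable.intros]
    has_moment[OF \<xi>2, THEN integrable.intros]
  note intros = Bochner_Integration.integrable_add Bochner_Integration.integrable_diff
    integrable_mult_right m
  have T: "lss_map \<theta> z = \<mu> + \<sigma> * (if \<xi> = 0 then z else (exp (\<xi> * z) - 1) / \<xi>)" for z
    by (simp add: lss_map_def \<mu>_def \<sigma>_def \<xi>_def)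
  have t: "lss_arg \<theta> (lss_map \<theta> z) = exp (\<xi> * z)" for z
    using \<sigma> by (simp add: lss_arg_map \<xi>_def)
  have sq: "exp (2 * \<xi> * z) = exp (\<xi> * z) * exp (\<xi> * z)" for z
    by (simp flip: exp_add)
  consider "\<xi> = 0" | "\<xi> \<noteq> 0" by blast
  then show ?thesis
  proof cases
    case 1
    have *: "f z * lss_potential \<theta> i (lss_map \<theta> z) =
        (if i = 1 then \<mu> * ?m 0 0 z + \<sigma> * ?m 1 0 z
         else if i = 2 then \<sigma> / 2 * ?m 2 0 z else \<sigma>\<^sup>2 / 6 * ?m 3 0 z)" for z
      unfolding lss_potential_def Let_def T defs
      using 1 \<sigma>_pos by (simp add: field_simps power2_eq_square power3_eq_cube)
    show ?thesis
      unfolding * by (cases "i = 1"; cases "i = 2"; simp only: simp_thms if_True if_False; intro intros)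
  next
    case 2
    have *: "f z * lss_potential \<theta> i (lss_map \<theta> z) =
        (if i = 1 then (\<mu> - \<sigma> / \<xi>) * ?m 0 0 z + \<sigma> / \<xi> * ?m 0 \<xi> z
         else if i = 2 then \<sigma> / (2 * \<xi>\<^sup>2) * (?m 0 (2 * \<xi>) z - 2 * ?m 0 \<xi> z + ?m 0 0 z)
         else \<sigma>\<^sup>2 / \<xi> ^ 3 * (\<xi> / 2 * ?m 1 (2 * \<xi>) z - 3 / 4 * ?m 0 (2 * \<xi>) z + ?m 0 \<xi> z))" for z
      unfolding lss_potential_def Let_def t unfolding T defs sq
      using 2 \<sigma>_pos by (simp add: field_simps power2_eq_square power3_eq_cube)
    show ?thesis
      unfolding * by (cases "i = 1"; cases "i = 2"; simp only: simp_thms if_True if_False; intro intros)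
  qed
qed

section \<open>Uniform domination and continuity at shape 0\<close>

text \<open>The bounds on \<open>exp u - 1\<close> and \<open>u * exp u - exp u + 1\<close> cancel
  the divisions by \<xi> and its square, which makes the estimate uniform in \<xi>, including 0. One
  crude majorant serves all three components.\<close>

lemma abs_lss_grad_le:
  assumes "0 < \<sigma>" "\<bar>\<xi>\<bar> \<le> d"
  shows "\<bar>lss_grad \<sigma> \<xi> i z\<bar> \<le> (1 + \<sigma>) * (1 + z\<^sup>2) * exp (d * \<bar>z\<bar>)"
proof -
  have d: "0 \<le> d" "exp \<bar>\<xi> * z\<bar> \<le> exp (d * \<bar>z\<bar>)" "1 \<le> exp (d * \<bar>z\<bar>)"
    using assms by (auto simp: abs_mult intro!: mult_right_mono)
  have z: "\<bar>z\<bar> \<le> 1 + z\<^sup>2"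
    using sum_squares_bound[of "\<bar>z\<bar>" 1] by simp
  have ge: "c * exp \<bar>\<xi> * z\<bar> \<le> (1 + \<sigma>) * (1 + z\<^sup>2) * exp (d * \<bar>z\<bar>)"
    if "0 \<le> c" "c \<le> (1 + \<sigma>) * (1 + z\<^sup>2)" for c
    using that d by (intro mult_mono) auto
  have "1 + z\<^sup>2 \<le> (1 + \<sigma>) * (1 + z\<^sup>2)" "\<sigma> * z\<^sup>2 \<le> (1 + \<sigma>) * (1 + z\<^sup>2)"
    using assms(1) by (auto simp: algebra_simps add_nonneg_nonneg)
  \<comment> \<open>The instances \<open>c = \<bar>z\<bar>\<close> for the scale component and
    \<open>c = \<sigma> * z\<^sup>2\<close> for the shape component.\<close>
  note ge1 = ge[OF _ order_trans[OF z this(1)]] and ge2 = ge[OF _ this(2)]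
  have one: "1 \<le> (1 + \<sigma>) * (1 + z\<^sup>2) * exp (d * \<bar>z\<bar>)"
  proof -
    have "1 * 1 * 1 \<le> (1 + \<sigma>) * (1 + z\<^sup>2) * exp (d * \<bar>z\<bar>)"
      using assms(1) d by (intro mult_mono) auto
    then show ?thesis by simp
  qed
  have g2: "\<bar>if \<xi> = 0 then z else (exp (\<xi> * z) - 1) / \<xi>\<bar> \<le> \<bar>z\<bar> * exp \<bar>\<xi> * z\<bar>"
  proof (cases "\<xi> = 0")
    case False
    then show ?thesis
      using abs_exp_minus_1_le[of "\<xi> * z"] by (simp add: abs_mult field_simps)
  qed simp
  have g3: "\<bar>\<sigma> * (if \<xi> = 0 then z\<^sup>2 / 2 else (\<xi> * z * exp (\<xi> * z) - exp (\<xi> * z) + 1) / \<xi>\<^sup>2)\<bar>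
      \<le> \<sigma> * z\<^sup>2 * exp \<bar>\<xi> * z\<bar>"
  proof (cases "\<xi> = 0")
    case True
    then show ?thesis
      using assms(1) by (simp add: abs_mult)
  next
    case False
    then have "\<bar>(\<xi> * z * exp (\<xi> * z) - exp (\<xi> * z) + 1) / \<xi>\<^sup>2\<bar> \<le> z\<^sup>2 * exp \<bar>\<xi> * z\<bar>"
      using abs_exp_remainder_le[of "\<xi> * z"] by (simp add: field_simps power_mult_distrib)
    then have "\<sigma> * \<bar>(\<xi> * z * exp (\<xi> * z) - exp (\<xi> * z) + 1) / \<xi>\<^sup>2\<bar> \<le> \<sigma> * (z\<^sup>2 * exp \<bar>\<xi> * z\<bar>)"
      using assms(1) by (intro mult_left_mono) auto
    then show ?thesis
      using False assms(1) by (simp add: abs_mult mult.assoc)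
  qed
  show ?thesis
    unfolding lss_grad_def
    using one order_trans[OF g2 ge1] order_trans[OF g3 ge2] assms(1) by simp
qed

lemma lss_grad_dominated:
  assumes \<sigma>: "0 < \<sigma>"
  obtains d w where "0 < d" "integrable lborel w"
    "\<And>\<xi> z i j. \<bar>\<xi>\<bar> \<le> d \<Longrightarrow> \<bar>f z * (lss_grad \<sigma> \<xi> i z * lss_grad \<sigma> \<xi> j z)\<bar> \<le> w z"
proof -
  \<comment> \<open>A product of two gradients has rate up to \<open>2 * d\<close>; the divisor 4
    keeps both \<open>2 * d\<close> and \<open>- (2 * d)\<close> strictly inside
    \<open>(a, b)\<close>.\<close>
  define d where "d = min (- a) b / 4"
  have d: "0 < d" "a < - (2 * d)" "- (2 * d) < b" "a < 2 * d" "2 * d < b"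
    using ab by (auto simp: d_def min_def field_simps)
  define C where "C = (1 + \<sigma>)\<^sup>2"
  let ?m = "\<lambda>k t z. z ^ k * exp (t * z) * f z"
  let ?w = "\<lambda>z. C * (?m 0 (- (2 * d)) z + 2 * ?m 2 (- (2 * d)) z + ?m 4 (- (2 * d)) z
    + ?m 0 (2 * d) z + 2 * ?m 2 (2 * d) z + ?m 4 (2 * d) z)"
  have "integrable lborel ?w"
    by (intro Bochner_Integration.integrable_add integrable_mult_right
        has_moment[THEN integrable.intros] d)
  moreover have "\<bar>f z * (lss_grad \<sigma> \<xi> i z * lss_grad \<sigma> \<xi> j z)\<bar> \<le> ?w z" if "\<bar>\<xi>\<bar> \<le> d" for \<xi> z i j
  proof -
    let ?K = "(1 + \<sigma>) * (1 + z\<^sup>2) * exp (d * \<bar>z\<bar>)"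
    have "\<bar>f z * (lss_grad \<sigma> \<xi> i z * lss_grad \<sigma> \<xi> j z)\<bar> \<le> f z * (?K * ?K)"
      unfolding abs_mult using \<sigma> nonneg[of z]
      by (intro mult_mono abs_lss_grad_le that) auto
    \<comment> \<open>The trivial factor \<open>exp (0 * z)\<close> lets \<open>exp_tilt_le\<close>
      apply with base rate 0 and margin \<open>2 * d\<close>.\<close>
    also have "?K * ?K = C * (1 + z\<^sup>2)\<^sup>2 * (exp (0 * z) * exp (2 * d * \<bar>z\<bar>))"
    proof -
      have "exp (2 * d * \<bar>z\<bar>) = exp (d * \<bar>z\<bar>) * exp (d * \<bar>z\<bar>)"
        by (simp flip: exp_add)
      then show ?thesis
        by (simp add: C_def power2_eq_square)
    qed
    also have "f z * \<dots> \<le> f z * (C * (1 + z\<^sup>2)\<^sup>2 * (exp (- (2 * d) * z) + exp (2 * d * z)))"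
      using d \<sigma> by (intro mult_left_mono exp_tilt_le nonneg) (auto simp: C_def)
    also have "\<dots> = ?w z"
      by (simp add: algebra_simps power2_eq_square power4_eq_xxxx)
    finally show ?thesis .
  qed
  ultimately show ?thesis
    using that d(1) by blast
qed

lemma measurable_lss_grad [measurable]: "lss_grad \<sigma> \<xi> i \<in> borel_measurable borel"
  unfolding lss_grad_def by (cases "i = 1"; cases "i = 2"; cases "\<xi> = 0") simp_all

text \<open>The branches of \<open>lss_grad\<close> at \<open>\<xi> = 0\<close> are the limits of
  the others: a derivative of the exponential for the scale, one use of l'Hopital's rule for the
  shape.\<close>

lemma tendsto_lss_grad: "((\<lambda>\<xi>. lss_grad \<sigma> \<xi> i z) \<longlongrightarrow> lss_grad \<sigma> 0 i z) (at 0)"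
proof -
  have lim2: "((\<lambda>\<xi>. (exp (\<xi> * z) - 1) / \<xi>) \<longlongrightarrow> z) (at 0)"
  proof -
    have "((\<lambda>\<xi>. exp (\<xi> * z)) has_real_derivative z) (at 0)"
      by (auto intro!: derivative_eq_intros)
    then show ?thesis
      by (simp add: has_field_derivative_iff)
  qed
  have lim3: "((\<lambda>\<xi>. (\<xi> * z * exp (\<xi> * z) - exp (\<xi> * z) + 1) / \<xi>\<^sup>2) \<longlongrightarrow> z\<^sup>2 / 2) (at 0)"
  proof (rule lhopital)
    show "((\<lambda>\<xi>. \<xi> * z * exp (\<xi> * z) - exp (\<xi> * z) + 1) \<longlongrightarrow> 0) (at 0)"
      by (auto intro!: tendsto_eq_intros)
    show "((\<lambda>\<xi>::real. \<xi>\<^sup>2) \<longlongrightarrow> 0) (at 0)"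
      by (auto intro!: tendsto_eq_intros)
    show "\<forall>\<^sub>F \<xi>::real in at 0. \<xi>\<^sup>2 \<noteq> 0" "\<forall>\<^sub>F \<xi>::real in at 0. 2 * \<xi> \<noteq> 0"
      by (auto simp: eventually_at_filter)
    show "\<forall>\<^sub>F \<xi> in at 0. ((\<lambda>\<xi>. \<xi> * z * exp (\<xi> * z) - exp (\<xi> * z) + 1) has_real_derivative
        \<xi> * z\<^sup>2 * exp (\<xi> * z)) (at \<xi>)"
      by (auto intro!: always_eventually derivative_eq_intros simp: power2_eq_square)
    show "\<forall>\<^sub>F \<xi>::real in at 0. ((\<lambda>\<xi>. \<xi>\<^sup>2) has_real_derivative 2 * \<xi>) (at \<xi>)"
      by (auto intro!: always_eventually derivative_eq_intros)
    have "((\<lambda>\<xi>. z\<^sup>2 * exp (\<xi> * z) / 2) \<longlongrightarrow> z\<^sup>2 / 2) (at 0)"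
      by (auto intro!: tendsto_eq_intros)
    then show "((\<lambda>\<xi>. \<xi> * z\<^sup>2 * exp (\<xi> * z) / (2 * \<xi>)) \<longlongrightarrow> z\<^sup>2 / 2) (at 0)"
      by (rule Lim_transform_eventually) (auto simp: eventually_at_filter)
  qed
  consider "i = 1" | "i = 2" | "i = 3"
    using exhaust_3[of i] by blast
  then show ?thesis
  proof cases
    case 1
    then show ?thesis
      by (simp add: lss_grad_def)
  next
    case 2
    then have "\<forall>\<^sub>F \<xi> in at 0. (exp (\<xi> * z) - 1) / \<xi> = lss_grad \<sigma> \<xi> i z"
      by (auto simp: eventually_at_filter lss_grad_def)
    with 2 show ?thesis
      using Lim_transform_eventually[OF lim2] by (simp add: lss_grad_def[of _ 0])
  next
    case 3
    then have "\<forall>\<^sub>F \<xi> in at 0. \<sigma> * ((\<xi> * z * exp (\<xi> * z) - exp (\<xi> * z) + 1) / \<xi>\<^sup>2) = lss_grad \<sigma> \<xi> i z"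
      by (auto simp: eventually_at_filter lss_grad_def)
    with 3 show ?thesis
      using Lim_transform_eventually[OF tendsto_mult_left[OF lim3, of \<sigma>]]
      by (simp add: lss_grad_def[of _ 0])
  qed
qed

lemma tendsto_integral_lss_grad:
  assumes "0 < \<sigma>"
  shows "((\<lambda>\<xi>. \<integral>z. f z * (lss_grad \<sigma> \<xi> i z * lss_grad \<sigma> \<xi> j z) \<partial>lborel) \<longlongrightarrow>
    (\<integral>z. f z * (lss_grad \<sigma> 0 i z * lss_grad \<sigma> 0 j z) \<partial>lborel)) (at 0)"
proof -
  obtain d w where d: "0 < d" and w: "integrable lborel w"
    and bound: "\<And>\<xi> z i j. \<bar>\<xi>\<bar> \<le> d \<Longrightarrow> \<bar>f z * (lss_grad \<sigma> \<xi> i z * lss_grad \<sigma> \<xi> j z)\<bar> \<le> w z"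
    using lss_grad_dominated[OF assms] by blast
  show ?thesis
    by (rule integral_dominated_convergence_at[OF d _ _ w])
      (auto intro!: tendsto_intros tendsto_lss_grad bound)
qed

text \<open>The closed form covers only \<open>\<xi> \<noteq> 0\<close>; at 0 integrability comes
  from the dominating function.\<close>

lemma integrable_lss_grad:
  assumes \<sigma>: "0 < \<sigma>" and \<xi>: "a < 2 * \<xi>" "2 * \<xi> < b"
  shows "integrable lborel (\<lambda>z. f z * (lss_grad \<sigma> \<xi> i z * lss_grad \<sigma> \<xi> j z))"
proof (cases "\<xi> = 0")
  case True
  obtain d w where d: "0 < d" and w: "integrable lborel w"
    and bound: "\<And>\<xi> z i j. \<bar>\<xi>\<bar> \<le> d \<Longrightarrow> \<bar>f z * (lss_grad \<sigma> \<xi> i z * lss_grad \<sigma> \<xi> j z)\<bar> \<le> w z"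
    using lss_grad_dominated[OF assms(1)] by blast
  show ?thesis
    by (rule Bochner_Integration.integrable_bound[OF w])
      (use bound[of 0] d True in \<open>auto intro!: AE_I2 order_trans[OF _ abs_ge_self]\<close>)
next
  case False
  show ?thesis
    using has_bochner_integral_lss_grad[OF False \<xi>] by (rule integrable.intros)
qed

section \<open>Expectations of the scores and of products of their derivatives\<close>

lemma has_bochner_integral_lss_score:
  assumes \<sigma>: "\<theta> $ 2 > 0" and \<xi>: "a < 2 * \<theta> $ 3" "2 * \<theta> $ 3 < b"
  shows "has_bochner_integral (law (lss_density f) \<theta>) (lss_score f \<theta> i) 0"
proof (rule has_bochner_integral_law[OF nonneg meas measurable_lss_score[OF \<sigma>] \<sigma>])
  let ?I = "\<integral>z. f z * lss_potential \<theta> i (lss_map \<theta> z) \<partial>lborel"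
  have int: "has_bochner_integral lborel (\<lambda>z. f z * lss_potential \<theta> i (lss_map \<theta> z)) ?I"
    by (rule has_bochner_integral_integrable[OF integrable_lss_potential[OF assms]])
  have mean: "(\<integral>y. lss_potential \<theta> i y \<partial>law (lss_density f) \<theta>) = ?I"
    by (rule has_bochner_integral_integral_eq
        [OF has_bochner_integral_law[OF nonneg meas measurable_lss_potential \<sigma> int]])
  \<comment> \<open>The centering constant equals \<open>?I\<close>, and \<open>f\<close> has total
    mass 1, so the two contributions cancel.\<close>
  have "has_bochner_integral lborel (\<lambda>z. f z * lss_potential \<theta> i (lss_map \<theta> z) - f z * ?I) (?I - 1 * ?I)"
    using density by (intro has_bochner_integral_diff int has_bochner_integral_mult_left)
      (simp add: prob_density_def)
  moreover have "(\<lambda>z. f z * lss_potential \<theta> i (lss_map \<theta> z) - f z * ?I) =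
      (\<lambda>z. f z * lss_score f \<theta> i (lss_map \<theta> z))"
    by (simp add: fun_eq_iff lss_score_def lss_map_in_domain[OF \<sigma>] mean right_diff_distrib)
  ultimately show "has_bochner_integral lborel (\<lambda>z. f z * lss_score f \<theta> i (lss_map \<theta> z)) 0"
    by simp
qed

lemma has_bochner_integral_deriv_lss_score:
  assumes \<sigma>: "\<theta> $ 2 > 0" and \<xi>: "a < 2 * \<theta> $ 3" "2 * \<theta> $ 3 < b"
  shows "has_bochner_integral (law (lss_density f) \<theta>)
    (\<lambda>x. deriv (lss_score f \<theta> i) x * deriv (lss_score f \<theta> j) x)
    (\<integral>z. f z * (lss_grad (\<theta> $ 2) (\<theta> $ 3) i z * lss_grad (\<theta> $ 2) (\<theta> $ 3) j z) \<partial>lborel)"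
proof (rule has_bochner_integral_law[OF nonneg meas _ \<sigma>])
  show "(\<lambda>x. deriv (lss_score f \<theta> i) x * deriv (lss_score f \<theta> j) x) \<in> borel_measurable borel"
    by (intro borel_measurable_times measurable_deriv_lss_score \<sigma>)
  show "has_bochner_integral lborel
      (\<lambda>z. f z * (deriv (lss_score f \<theta> i) (lss_map \<theta> z) * deriv (lss_score f \<theta> j) (lss_map \<theta> z)))
      (\<integral>z. f z * (lss_grad (\<theta> $ 2) (\<theta> $ 3) i z * lss_grad (\<theta> $ 2) (\<theta> $ 3) j z) \<partial>lborel)"
    using has_bochner_integral_integrable[OF integrable_lss_grad[OF assms]]
    by (simp add: deriv_lss_score[OF \<sigma> lss_map_in_domain[OF \<sigma>]] lss_potential_deriv_map[OF \<sigma>])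
qed

end

theorem theorem2:
  fixes \<Xi> :: "real set" and f :: "real \<Rightarrow> real" and \<theta> :: "real ^ 3"
  assumes "open \<Xi>" and "0 \<in> \<Xi>"
    and "C4 f" and "prob_density f"
    and "\<forall>t \<in> {2 * \<xi> | \<xi>. \<xi> \<in> \<Xi>}. mgf_finite f t"
    and "\<theta> $ 2 > 0" and "\<theta> $ 3 \<in> \<Xi>"
  shows "(\<forall>i. wasserstein_score (lss_density f) (lss_domain \<theta>) \<theta> i (lss_score f \<theta> i)) \<and>
    (\<forall>i j. integrable (law (lss_density f) \<theta>)
              (\<lambda>x. deriv (lss_score f \<theta> i) x * deriv (lss_score f \<theta> j) x)) \<and>
    (\<theta> $ 3 \<noteq> 0 \<longrightarrow>
       wasserstein_information (lss_density f) \<theta> (lss_score f \<theta>)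
         = lss_information_formula (mgf f) (\<theta> $ 2) (\<theta> $ 3)) \<and>
    (\<theta> $ 3 = 0 \<longrightarrow>
       ((\<lambda>\<xi>. lss_information_formula (mgf f) (\<theta> $ 2) \<xi>)
         \<longlongrightarrow> wasserstein_information (lss_density f) \<theta> (lss_score f \<theta>)) (at 0))"
proof -
  let ?\<sigma> = "\<theta> $ 2" and ?\<xi> = "\<theta> $ 3"
  note \<sigma> = assms(6)
  obtain a b where ab: "mgf_finite f a" "mgf_finite f b" "a < 0" "0 < b"
    and \<xi>: "a < 2 * ?\<xi>" "2 * ?\<xi> < b"
    using exponent_interval[OF assms(1,2,7,5)] by blast
  interpret exp_moments f a b
    by unfold_locales (use assms(4) ab in auto)
  have f: "(f has_real_derivative deriv f x) (at x)" for x
  proof -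
    have "\<forall>x. (deriv ^^ 0) f differentiable at x"
      using assms(3) unfolding C4_def by (metis zero_less_numeral)
    then show ?thesis
      by (simp add: DERIV_deriv_iff_real_differentiable)
  qed
  \<comment> \<open>The common integral representation: it equals the information matrix at the
    given shape, zero or not, and the closed form at nonzero shapes with \<open>2 * \<xi>\<close> in
    \<open>(a, b)\<close>.\<close>
  define G where "G \<xi> i j = (\<integral>z. f z * (lss_grad ?\<sigma> \<xi> i z * lss_grad ?\<sigma> \<xi> j z) \<partial>lborel)" for \<xi> i j
  note deriv_score = has_bochner_integral_deriv_lss_score[OF \<sigma> \<xi>]
  have formula: "lss_information_formula (mgf f) ?\<sigma> \<xi> = (\<chi> i j. G \<xi> i j)"
    if "\<xi> \<noteq> 0" "a < 2 * \<xi>" "2 * \<xi> < b" for \<xi>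
    using has_bochner_integral_integral_eq[OF has_bochner_integral_lss_grad[OF that]]
    by (simp add: vec_eq_iff G_def)
  have info: "wasserstein_information (lss_density f) \<theta> (lss_score f \<theta>) = (\<chi> i j. G ?\<xi> i j)"
    using has_bochner_integral_integral_eq[OF deriv_score]
    by (simp add: wasserstein_information_def vec_eq_iff G_def)
  show ?thesis
  proof (intro conjI allI impI)
    fix i
    show "wasserstein_score (lss_density f) (lss_domain \<theta>) \<theta> i (lss_score f \<theta> i)"
      unfolding wasserstein_score_def
    proof (intro conjI ballI)
      fix x assume x: "x \<in> lss_domain \<theta>"
      show "lss_score f \<theta> i differentiable at x"
        using lss_score_has_derivative[OF \<sigma> x] by (auto simp: real_differentiable_def)
      show "\<exists>d. ((\<lambda>s. lss_density f (\<theta> + s *\<^sub>R axis i 1) x) has_real_derivative d) (at 0) \<and>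
          ((\<lambda>y. lss_density f \<theta> y * deriv (lss_score f \<theta> i) y) has_real_derivative - d) (at x)"
        by (rule lss_score_equation[OF f \<sigma> x])
    qed (rule has_bochner_integral_lss_score[OF \<sigma> \<xi>])
  next
    fix i j
    show "integrable (law (lss_density f) \<theta>)
        (\<lambda>x. deriv (lss_score f \<theta> i) x * deriv (lss_score f \<theta> j) x)"
      using deriv_score by (rule integrable.intros)
  next
    assume "?\<xi> \<noteq> 0"
    then show "wasserstein_information (lss_density f) \<theta> (lss_score f \<theta>) =
        lss_information_formula (mgf f) ?\<sigma> ?\<xi>"
      using info formula \<xi> by simp
  next
    assume "?\<xi> = 0"
    have "((\<lambda>\<xi>. \<chi> i j. G \<xi> i j) \<longlongrightarrow> (\<chi> i j. G 0 i j)) (at 0)"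
      unfolding G_def by (intro tendsto_vec_lambda tendsto_integral_lss_grad \<sigma>)
    moreover have "\<forall>\<^sub>F \<xi> in at 0. (\<chi> i j. G \<xi> i j) = lss_information_formula (mgf f) ?\<sigma> \<xi>"
    proof -
      \<comment> \<open>In this interval \<open>2 * \<xi>\<close> stays in \<open>(a, b)\<close>;
        the punctured filter supplies the remaining condition \<open>\<xi> \<noteq> 0\<close> of
        \<open>formula\<close>.\<close>
      have "\<forall>\<^sub>F \<xi> in nhds 0. \<xi> \<in> {a / 2<..<b / 2}"
        using ab by (intro eventually_nhds_in_open) auto
      then show ?thesis
        unfolding eventually_at_filter by eventually_elim (auto simp: formula)
    qed
    ultimately show "((\<lambda>\<xi>. lss_information_formula (mgf f) ?\<sigma> \<xi>)
        \<longlongrightarrow> wasserstein_information (lss_density f) \<theta> (lss_score f \<theta>)) (at 0)"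
      unfolding info \<open>?\<xi> = 0\<close> by (rule Lim_transform_eventually)
  qed
qed

end
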